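(* Let $G$ be a finite group, $N\trianglelefteq G$ and $x\in\Omega(G/N)$. Then $$\mathfrak n_G\left(\operatorname{Inf}_{G/N}^{G}(x)\right)=\operatorname{Inf}_{G/N}^{G}\left(\mathfrak n_{G/N}(x)\right).$$ More explicitly, for every $M\trianglelefteq G$, $$c_M^G\left(\operatorname{Inf}_{G/N}^{G}(x)\right)=\begin{cases}c_{M/N}^{G/N}(x),&N\leq M,\\ 0,&N\nleq M.\end{cases}$$
   Context: For a finite group $G$, $\Omega(G)$ is the Burnside ring (Grothendieck ring of finite $G$-sets), with $\mathbb Z$-basis $[G/H]$, $(H)$ running over the conjugacy classes of subgroups of $G$. With $\operatorname{core}_G(H)=\bigcap_{g\in G}gHg^{-1}$, for $x=\sum_{(H)}a_H[G/H]\in\Omega(G)$ and $M\trianglelefteq G$ the $M$-core coefficient is $c_M^G(x)=\sum_{(H):\,\operatorname{core}_G(H)=M}a_H$. The normal-core compression $\mathfrak n_G:\Omega(G)\to\Omega(G)$ is the additive map with $\mathfrak n_G([G/H])=[G/\operatorname{core}_G(H)]$, i.e. $\mathfrak n_G(x)=\sum_{M\trianglelefteq G}c_M^G(x)[G/M]$. For $N\trianglelefteq G$, inflation $\operatorname{Inf}_{G/N}^G:\Omega(G/N)\to\Omega(G)$ is the unital ring homomorphism obtained by viewing a $G/N$-set as a $G$-set via $G\to G/N$; on the basis, $[(G/N)/(H/N)]\mapsto[G/H]$ for $N\le H\le G$. *)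

theory Defs
  imports "HOL-Algebra.Group_Action" "HOL-Algebra.Left_Coset" "HOL-Algebra.Ring"
begin

section \<open>Finite G-sets\<close>

text \<open>A pair \<open>(E, \<phi>)\<close> is a \<open>G\<close>-set when \<open>group_action G E \<phi>\<close> holds. Since the library requires the
  permutations \<open>\<phi> g\<close> to be extensional, the actions below are restricted to their carriers.\<close>

type_synonym ('a, 'x) gset = "'x set \<times> ('a \<Rightarrow> 'x \<Rightarrow> 'x)"

definition finite_gset :: "('a, 'b) monoid_scheme \<Rightarrow> ('a, 'x) gset \<Rightarrow> bool" where
  "finite_gset G X \<longleftrightarrow> finite (fst X) \<and> group_action G (fst X) (snd X)"

definition gset_iso :: "('a, 'b) monoid_scheme \<Rightarrow> ('a, 'x) gset \<Rightarrow> ('a, 'y) gset \<Rightarrow> bool" where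
  "gset_iso G X Y \<longleftrightarrow>
     (\<exists>f. bij_betw f (fst X) (fst Y) \<and>
          (\<forall>g\<in>carrier G. \<forall>p\<in>fst X. f (snd X g p) = snd Y g (f p)))"

definition gset_sum :: "('a, 'x) gset \<Rightarrow> ('a, 'y) gset \<Rightarrow> ('a, 'x + 'y) gset" where
  "gset_sum X Y =
     (fst X <+> fst Y, \<lambda>g. restrict (map_sum (snd X g) (snd Y g)) (fst X <+> fst Y))"

definition gset_prod :: "('a, 'x) gset \<Rightarrow> ('a, 'y) gset \<Rightarrow> ('a, 'x \<times> 'y) gset" where
  "gset_prod X Y =
     (fst X \<times> fst Y, \<lambda>g. restrict (map_prod (snd X g) (snd Y g)) (fst X \<times> fst Y))"

definition gset_empty :: "('a, nat) gset" where
  "gset_empty = ({}, \<lambda>g. restrict id {})"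

definition gset_point :: "('a, nat) gset" where
  "gset_point = ({0}, \<lambda>g. restrict id {0})"

text \<open>The transitive \<open>G\<close>-set \<open>G/H\<close> of left cosets.\<close>

definition coset_gset :: "('a, 'b) monoid_scheme \<Rightarrow> 'a set \<Rightarrow> ('a, 'a set) gset" where
  "coset_gset G H = (lcosets\<^bsub>G\<^esub> H, \<lambda>g. \<lambda>C\<in>lcosets\<^bsub>G\<^esub> H. g <#\<^bsub>G\<^esub> C)"

section \<open>The Burnside ring\<close>

text \<open>The Grothendieck ring of finite \<open>G\<close>-sets. The class \<open>[X] - [Y]\<close> consists of all pairs \<open>(P, Q)\<close>
  of finite \<open>G\<close>-sets that are equivalent to \<open>(X, Y)\<close> in the Grothendieck construction, that is,
  \<open>P + Y + Z\<close> is isomorphic to \<open>X + Q + Z\<close> for some finite \<open>G\<close>-set \<open>Z\<close>.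
  As every finite \<open>G\<close>-set is isomorphic to one whose points are natural numbers, it suffices to let
  \<open>P\<close>, \<open>Q\<close>, \<open>Z\<close> range over those; \<open>X\<close> and \<open>Y\<close> may live on any type.\<close>

type_synonym 'a burnside = "(('a, nat) gset \<times> ('a, nat) gset) set"

definition burnside_diff ::
    "('a, 'b) monoid_scheme \<Rightarrow> ('a, 'x) gset \<Rightarrow> ('a, 'y) gset \<Rightarrow> 'a burnside" where
  "burnside_diff G X Y =
     {(P, Q). finite_gset G P \<and> finite_gset G Q \<and>
        (\<exists>Z :: ('a, nat) gset. finite_gset G Z \<and>
           gset_iso G (gset_sum (gset_sum P Y) Z) (gset_sum (gset_sum X Q) Z))}"

definition burnside_class :: "('a, 'b) monoid_scheme \<Rightarrow> ('a, 'x) gset \<Rightarrow> 'a burnside" where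
  "burnside_class G X = burnside_diff G X gset_empty"

text \<open>The operations are induced from representatives; each union is over one and the same class.\<close>

definition burnside_ring :: "('a, 'b) monoid_scheme \<Rightarrow> 'a burnside ring" where
  "burnside_ring G =
     \<lparr>carrier = {burnside_diff G X Y | (X :: ('a, nat) gset) (Y :: ('a, nat) gset).
                   finite_gset G X \<and> finite_gset G Y},
      mult = (\<lambda>x y. \<Union>(X, Y)\<in>x. \<Union>(X', Y')\<in>y.
                burnside_diff G (gset_sum (gset_prod X X') (gset_prod Y Y'))
                                (gset_sum (gset_prod X Y') (gset_prod Y X'))),
      one = burnside_class G gset_point,
      zero = burnside_class G gset_empty,
      add = (\<lambda>x y. \<Union>(X, Y)\<in>x. \<Union>(X', Y')\<in>y.
               burnside_diff G (gset_sum X X') (gset_sum Y Y'))\<rparr>"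

section \<open>Coefficients in the standard basis\<close>

definition conj_classes :: "('a, 'b) monoid_scheme \<Rightarrow> 'a set set set" where
  "conj_classes G =
     orbits G {H. subgroup H G} (\<lambda>g. \<lambda>H\<in>{H. subgroup H G}. g <#\<^bsub>G\<^esub> H #>\<^bsub>G\<^esub> inv\<^bsub>G\<^esub> g)"

text \<open>One subgroup from each conjugacy class. The choice is immaterial, as \<open>[G/H]\<close> and the normal
  core of \<open>H\<close> depend only on the conjugacy class of \<open>H\<close>.\<close>

definition subgroup_reps :: "('a, 'b) monoid_scheme \<Rightarrow> 'a set set" where
  "subgroup_reps G = (\<lambda>C. SOME H. H \<in> C) ` conj_classes G"

text \<open>The integers \<open>a\<^sub>H\<close> with \<open>x = \<Sum> a\<^sub>H [G/H]\<close>; they are unique because the classes \<open>[G/H]\<close> form a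
  basis.\<close>

definition burnside_coeffs ::
    "('a, 'b) monoid_scheme \<Rightarrow> 'a burnside \<Rightarrow> 'a set \<Rightarrow> int" where
  "burnside_coeffs G x =
     (THE a. a \<in> extensional (subgroup_reps G) \<and>
        x = (\<Oplus>\<^bsub>burnside_ring G\<^esub>H\<in>subgroup_reps G.
               [a H] \<cdot>\<^bsub>burnside_ring G\<^esub> burnside_class G (coset_gset G H)))"

definition normal_core :: "('a, 'b) monoid_scheme \<Rightarrow> 'a set \<Rightarrow> 'a set" where
  "normal_core G H = (\<Inter>g\<in>carrier G. g <#\<^bsub>G\<^esub> H #>\<^bsub>G\<^esub> inv\<^bsub>G\<^esub> g)"

definition core_coeff ::
    "('a, 'b) monoid_scheme \<Rightarrow> 'a set \<Rightarrow> 'a burnside \<Rightarrow> int" where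
  "core_coeff G M x =
     (\<Sum>H\<in>{H \<in> subgroup_reps G. normal_core G H = M}. burnside_coeffs G x H)"

text \<open>The additive map with \<open>[G/H] \<mapsto> [G/core H]\<close>.\<close>

definition core_compression ::
    "('a, 'b) monoid_scheme \<Rightarrow> 'a burnside \<Rightarrow> 'a burnside" where
  "core_compression G x =
     (\<Oplus>\<^bsub>burnside_ring G\<^esub>H\<in>subgroup_reps G.
        [burnside_coeffs G x H] \<cdot>\<^bsub>burnside_ring G\<^esub>
          burnside_class G (coset_gset G (normal_core G H)))"

section \<open>Inflation\<close>

text \<open>Note that \<open>G Mod N\<close> consists of the right cosets of \<open>N\<close>, so the projection is
  \<open>g \<mapsto> N #> g\<close>.\<close>

definition inflate_gset ::
    "('a, 'b) monoid_scheme \<Rightarrow> 'a set \<Rightarrow> ('a set, 'x) gset \<Rightarrow> ('a, 'x) gset" where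
  "inflate_gset G N X = (fst X, \<lambda>g. snd X (N #>\<^bsub>G\<^esub> g))"

definition inflation ::
    "('a, 'b) monoid_scheme \<Rightarrow> 'a set \<Rightarrow> 'a set burnside \<Rightarrow> 'a burnside" where
  "inflation G N x = (\<Union>(X, Y)\<in>x. burnside_diff G (inflate_gset G N X) (inflate_gset G N Y))"

end

(* Count, for a finite G-set X and a subgroup H, the points of X whose stabilizer is exactly H.
   These counts are additive, and removing orbits one at a time shows that they determine X up to
   isomorphism. Hence Omega(G) embeds into the integer-valued functions on subgroups. The count of
   G/K at H is nonzero only if H and K are conjugate, so the coefficient of [G/H] in x is the
   value of x at H divided by that of [G/H] at H.

   Stabilizers of an inflated set are preimages of stabilizers in G/N. So the value of Inf(x) at H
   is that of x at H/N if N is contained in H, and 0 otherwise, and the coefficients behave in the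
   same way. As H -> H/N respects conjugacy and normal cores, both claims follow by matching the
   conjugacy classes of subgroups containing N with those of subgroups of G/N. *)

theory Submission
  imports Defs
begin

section \<open>Equivariant maps and orbits\<close>

text \<open>Exact stabilizers are counted, rather than the fixed points \<open>|X^H|\<close> of the
  classical table of marks, because fixed points give only a triangular system, to be solved by
  Moebius inversion. Here the system is diagonal up to conjugacy, and one division isolates a
  coefficient. The divisor is the index of \<open>H\<close> in its normalizer; for \<open>H\<close>
  above \<open>N\<close> it is the same for \<open>H/N\<close>, which is why the quotients transfer.

  The obstacle is choice. Ring elements are sets of pairs, coefficients are a definite description,
  and the representatives of conjugacy classes are picked independently in \<open>G\<close> and in
  \<open>G Mod N\<close>, so the image of a representative need not be one. Hence an element is
  handled through its integer function \<open>mark\<close>, and coefficients through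
  \<open>basis_coeff\<close>, which makes sense at every subgroup and is constant on conjugacy
  classes. Sums over the two sets of representatives are compared only for conjugation-invariant
  summands.\<close>

lemma (in group) group_actionI:
  assumes "\<And>g. g \<in> carrier G \<Longrightarrow> \<phi> g \<in> extensional E"
    and closed: "\<And>g p. g \<in> carrier G \<Longrightarrow> p \<in> E \<Longrightarrow> \<phi> g p \<in> E"
    and one: "\<And>p. p \<in> E \<Longrightarrow> \<phi> \<one> p = p"
    and mult: "\<And>g h p. g \<in> carrier G \<Longrightarrow> h \<in> carrier G \<Longrightarrow> p \<in> E \<Longrightarrow> \<phi> (g \<otimes> h) p = \<phi> g (\<phi> h p)"
  shows "group_action G E \<phi>"
proof -
  have bij: "\<phi> g \<in> Bij E" if g: "g \<in> carrier G" for g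
  proof -
    have "bij_betw (\<phi> g) E E"
    proof (rule bij_betw_byWitness[where f' = "\<phi> (inv g)"])
      show "\<forall>p\<in>E. \<phi> (inv g) (\<phi> g p) = p" "\<forall>p\<in>E. \<phi> g (\<phi> (inv g) p) = p"
        using mult[of "inv g" g] mult[of g "inv g"] g one by auto
    qed (use closed g in auto)
    then show ?thesis
      using assms(1) g by (simp add: Bij_def)
  qed
  \<comment> \<open>An equation of functions on the whole type: it follows from the pointwise law
    because both sides are extensional on \<open>E\<close>.\<close>
  have "\<phi> (g \<otimes> h) = compose E (\<phi> g) (\<phi> h)" if "g \<in> carrier G" "h \<in> carrier G" for g h
    using that assms(1) mult by (intro extensionalityI[of _ E]) (auto simp: compose_def)
  then show ?thesis
    unfolding group_action_def group_hom_def group_hom_axioms_def hom_def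
    using bij group_BijGroup by (auto simp: BijGroup_def)
qed

lemma (in group_action) action_closed: "g \<in> carrier G \<Longrightarrow> p \<in> E \<Longrightarrow> \<phi> g p \<in> E"
  using element_image by blast

lemma (in group_action) action_one: "p \<in> E \<Longrightarrow> \<phi> \<one> p = p"
  using id_eq_one by (metis restrict_apply')

lemma (in group_action) action_extensional: "g \<in> carrier G \<Longrightarrow> \<phi> g \<in> extensional E"
  using bij_prop0 by (simp add: Bij_def)

lemma (in group_action) action_inv_cancel:
  "g \<in> carrier G \<Longrightarrow> p \<in> E \<Longrightarrow> \<phi> (inv g) (\<phi> g p) = p"
  using orbit_sym_aux by blast

text \<open>A pointwise orbit-stabilizer theorem. Well-definedness and injectivity of a map from
  \<open>g p\<close> to \<open>g q\<close> both come from this equivalence.\<close>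

lemma (in group_action) action_eq_iff:
  assumes "g \<in> carrier G" "h \<in> carrier G" "p \<in> E"
  shows "\<phi> g p = \<phi> h p \<longleftrightarrow> inv g \<otimes> h \<in> stabilizer G \<phi> p"
proof -
  interpret group G using group_hom group_hom.axioms(1) by auto
  have "\<phi> (inv g) (\<phi> h p) = p \<longleftrightarrow> \<phi> h p = \<phi> g p"
    using assms action_closed action_inv_cancel orbit_sym_aux[of "inv g" "\<phi> h p" p]
    by (metis inv_closed inv_inv)
  then show ?thesis
    using assms composition_rule[of p "inv g" h] by (auto simp: stabilizer_def)
qed

lemma (in group) mem_conj_iff:
  assumes "g \<in> carrier G" "H \<subseteq> carrier G" "k \<in> carrier G"
  shows "k \<in> g <# H #> inv g \<longleftrightarrow> inv g \<otimes> k \<otimes> g \<in> H"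
proof
  assume "k \<in> g <# H #> inv g"
  then obtain h where h: "h \<in> H" "k = g \<otimes> h \<otimes> inv g"
    by (auto simp: l_coset_def r_coset_def)
  with assms have "h \<in> carrier G" by auto
  with h assms have "inv g \<otimes> k \<otimes> g = h"
    by (metis inv_solve_left' inv_solve_right' m_assoc m_closed inv_closed)
  with h show "inv g \<otimes> k \<otimes> g \<in> H" by simp
next
  assume "inv g \<otimes> k \<otimes> g \<in> H"
  moreover have "k = g \<otimes> (inv g \<otimes> k \<otimes> g) \<otimes> inv g"
    using assms conjugation_is_surj[of g k] by simp
  ultimately show "k \<in> g <# H #> inv g"
    by (auto simp: l_coset_def r_coset_def)
qed

lemma (in group) conj_subset:
  "g \<in> carrier G \<Longrightarrow> H \<subseteq> carrier G \<Longrightarrow> g <# H #> inv g \<subseteq> carrier G"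
  by (simp add: l_coset_subset_G r_coset_subset_G)

lemma (in group_action) stabilizer_action:
  assumes g: "g \<in> carrier G" and p: "p \<in> E"
  shows "stabilizer G \<phi> (\<phi> g p) = g <# stabilizer G \<phi> p #> inv g"
proof -
  interpret group G using group_hom group_hom.axioms(1) by auto
  have sub: "stabilizer G \<phi> p \<subseteq> carrier G" by (rule stabilizer_subset)
  have "k \<in> stabilizer G \<phi> (\<phi> g p) \<longleftrightarrow> k \<in> g <# stabilizer G \<phi> p #> inv g" if k: "k \<in> carrier G" for k
  proof -
    have "k \<in> stabilizer G \<phi> (\<phi> g p) \<longleftrightarrow> \<phi> g p = \<phi> (k \<otimes> g) p"
      using k g p composition_rule by (auto simp: stabilizer_def)
    also have "\<dots> \<longleftrightarrow> inv g \<otimes> k \<otimes> g \<in> stabilizer G \<phi> p"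
      using k g p by (simp add: action_eq_iff m_assoc)
    finally show ?thesis
      using mem_conj_iff[OF g sub k] by simp
  qed
  then show ?thesis
    using stabilizer_subset conj_subset[OF g sub] by blast
qed

text \<open>\<open>gset_iso\<close> speaks of arbitrary pairs and is not symmetric there:
  \<open>inv_into\<close> undoes \<open>f\<close> at \<open>snd X g p\<close> only if that point
  lies in \<open>fst X\<close>. Hence the action hypothesis on \<open>X\<close>.\<close>

lemma gset_iso_sym:
  assumes "finite_gset G X" "gset_iso G X Y"
  shows "gset_iso G Y X"
proof -
  obtain f where f: "bij_betw f (fst X) (fst Y)"
      "\<And>g p. g \<in> carrier G \<Longrightarrow> p \<in> fst X \<Longrightarrow> f (snd X g p) = snd Y g (f p)"
    using assms(2) by (auto simp: gset_iso_def)
  interpret group_action G "fst X" "snd X" using assms by (simp add: finite_gset_def)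
  show ?thesis
    unfolding gset_iso_def
  proof (intro exI[of _ "inv_into (fst X) f"] conjI ballI)
    fix g q assume g: "g \<in> carrier G" and q: "q \<in> fst Y"
    then obtain p where p: "p \<in> fst X" "q = f p" using f(1) by (auto simp: bij_betw_def)
    then show "inv_into (fst X) f (snd Y g q) = snd X g (inv_into (fst X) f q)"
      using f g action_closed by (metis bij_betw_def inv_into_f_f)
  qed (use f in \<open>simp add: bij_betw_inv_into\<close>)
qed

lemma gset_iso_trans:
  assumes "gset_iso G X Y" "gset_iso G Y Z"
  shows "gset_iso G X Z"
proof -
  obtain f where f: "bij_betw f (fst X) (fst Y)"
      "\<forall>g\<in>carrier G. \<forall>p\<in>fst X. f (snd X g p) = snd Y g (f p)"
    using assms(1) by (auto simp: gset_iso_def)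
  obtain f' where f': "bij_betw f' (fst Y) (fst Z)"
      "\<forall>g\<in>carrier G. \<forall>p\<in>fst Y. f' (snd Y g p) = snd Z g (f' p)"
    using assms(2) by (auto simp: gset_iso_def)
  show ?thesis
    unfolding gset_iso_def using f f' bij_betw_trans[OF f(1) f'(1)]
    by (intro exI[of _ "f' \<circ> f"]) (auto simp: bij_betwE)
qed

lemma gset_iso_sum:
  assumes "gset_iso G X X'" "gset_iso G Y Y'" "finite_gset G X" "finite_gset G Y"
  shows "gset_iso G (gset_sum X Y) (gset_sum X' Y')"
proof -
  interpret X: group_action G "fst X" "snd X" using assms by (simp add: finite_gset_def)
  interpret Y: group_action G "fst Y" "snd Y" using assms by (simp add: finite_gset_def)
  obtain f where f: "bij_betw f (fst X) (fst X')"
      "\<forall>g\<in>carrier G. \<forall>p\<in>fst X. f (snd X g p) = snd X' g (f p)"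
    using assms(1) by (auto simp: gset_iso_def)
  obtain f' where f': "bij_betw f' (fst Y) (fst Y')"
      "\<forall>g\<in>carrier G. \<forall>p\<in>fst Y. f' (snd Y g p) = snd Y' g (f' p)"
    using assms(2) by (auto simp: gset_iso_def)
  have "bij_betw (map_sum f f') (fst X <+> fst Y) (fst X' <+> fst Y')"
    using bij_betw_inv_into_left[OF f(1)] bij_betw_inv_into_right[OF f(1)]
      bij_betw_inv_into_left[OF f'(1)] bij_betw_inv_into_right[OF f'(1)]
      bij_betwE[OF f(1)] bij_betwE[OF f'(1)]
      bij_betwE[OF bij_betw_inv_into[OF f(1)]] bij_betwE[OF bij_betw_inv_into[OF f'(1)]]
    by (intro bij_betw_byWitness[where f' = "map_sum (inv_into (fst X) f) (inv_into (fst Y) f')"]) auto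
  then show ?thesis
    unfolding gset_iso_def gset_sum_def using f f'
    by (intro exI[of _ "map_sum f f'"])
      (auto simp: X.action_closed Y.action_closed bij_betwE)
qed

lemma (in group) finite_gset_sum:
  assumes "finite_gset G X" "finite_gset G Y"
  shows "finite_gset G (gset_sum X Y)"
proof -
  interpret X: group_action G "fst X" "snd X" using assms by (simp add: finite_gset_def)
  interpret Y: group_action G "fst Y" "snd Y" using assms by (simp add: finite_gset_def)
  show ?thesis
    unfolding finite_gset_def
  proof
    show "group_action G (fst (gset_sum X Y)) (snd (gset_sum X Y))"
      by (rule group_actionI)
        (auto simp: gset_sum_def X.action_closed Y.action_closed X.action_one Y.action_one
          X.composition_rule Y.composition_rule)
  qed (use assms in \<open>simp add: gset_sum_def finite_gset_def\<close>)
qed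

lemma (in group) finite_gset_empty: "finite_gset G gset_empty"
  unfolding finite_gset_def by (auto simp: gset_empty_def intro: group_actionI)

text \<open>Transport of structure along an enumeration. The members of a class live on natural
  numbers, so a set such as \<open>G/H\<close>, made of cosets, reaches its own class only through
  such a copy.\<close>

lemma (in group) gset_nat_copy:
  assumes "finite_gset G X"
  obtains P :: "('a, nat) gset" where "finite_gset G P" "gset_iso G X P"
proof -
  interpret X: group_action G "fst X" "snd X" using assms by (simp add: finite_gset_def)
  obtain f n where f: "bij_betw f (fst X) {0..<n::nat}"
    using assms ex_bij_betw_finite_nat unfolding finite_gset_def by blast
  let ?h = "inv_into (fst X) f"
  have h: "bij_betw ?h {0..<n} (fst X)" using f by (rule bij_betw_inv_into)
  have hf: "?h (f p) = p" if "p \<in> fst X" for p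
    using f that by (simp add: bij_betw_def)
  have fh: "f (?h i) = i" if "i < n" for i
    using f that by (simp add: bij_betw_inv_into_right)
  have hX: "?h i \<in> fst X" if "i < n" for i
    using h that by (simp add: bij_betwE)
  have fX: "f p < n" if "p \<in> fst X" for p
    using f that by (auto dest: bij_betwE)
  define P :: "('a, nat) gset" where "P = ({0..<n}, \<lambda>g. \<lambda>i\<in>{0..<n}. f (snd X g (?h i)))"
  have "group_action G (fst P) (snd P)"
    by (rule group_actionI)
      (auto simp: P_def fX hX X.action_closed X.action_one X.composition_rule hf fh)
  then have "finite_gset G P" by (simp add: finite_gset_def P_def)
  moreover have "gset_iso G X P"
    unfolding gset_iso_def using f by (intro exI[of _ f]) (auto simp: P_def hf fX)
  ultimately show thesis by (rule that)
qed

section \<open>Counting points with a given stabilizer\<close>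

definition stab_count :: "('a, 'b) monoid_scheme \<Rightarrow> ('a, 'x) gset \<Rightarrow> 'a set \<Rightarrow> nat" where
  "stab_count G X H = card {p \<in> fst X. stabilizer G (snd X) p = H}"

lemma stab_count_empty [simp]: "stab_count G gset_empty H = 0"
  by (simp add: stab_count_def gset_empty_def)

lemma stab_count_sum:
  assumes "finite_gset G X" "finite_gset G Y"
  shows "stab_count G (gset_sum X Y) H = stab_count G X H + stab_count G Y H"
proof -
  have "stabilizer G (snd (gset_sum X Y)) (Inl p) = stabilizer G (snd X) p" if "p \<in> fst X" for p
    using that by (simp add: gset_sum_def stabilizer_def InlI InrI)
  moreover have "stabilizer G (snd (gset_sum X Y)) (Inr p) = stabilizer G (snd Y) p" if "p \<in> fst Y" for p
    using that by (simp add: gset_sum_def stabilizer_def InlI InrI)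
  moreover have "fst (gset_sum X Y) = fst X <+> fst Y"
    by (simp add: gset_sum_def)
  ultimately have "{p \<in> fst (gset_sum X Y). stabilizer G (snd (gset_sum X Y)) p = H} =
      {p \<in> fst X. stabilizer G (snd X) p = H} <+> {p \<in> fst Y. stabilizer G (snd Y) p = H}"
    by auto
  then show ?thesis
    using assms by (simp add: stab_count_def finite_gset_def card_Plus)
qed

text \<open>An equivariant map can only enlarge stabilizers, and an injective one preserves
  them.\<close>

lemma stab_count_iso:
  assumes "finite_gset G X" "gset_iso G X Y"
  shows "stab_count G X H = stab_count G Y H"
proof -
  obtain f where f: "bij_betw f (fst X) (fst Y)"
      "\<And>g p. g \<in> carrier G \<Longrightarrow> p \<in> fst X \<Longrightarrow> f (snd X g p) = snd Y g (f p)"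
    using assms(2) by (auto simp: gset_iso_def)
  interpret group_action G "fst X" "snd X" using assms by (simp add: finite_gset_def)
  have stab: "stabilizer G (snd Y) (f p) = stabilizer G (snd X) p" if "p \<in> fst X" for p
    unfolding stabilizer_def using f that action_closed
    by (metis (no_types, opaque_lifting) bij_betw_def inj_on_eq_iff)
  have "bij_betw f {p \<in> fst X. stabilizer G (snd X) p = H} {p \<in> fst Y. stabilizer G (snd Y) p = H}"
    using f(1) by (rule bij_betw_Collect) (simp add: stab)
  then show ?thesis
    unfolding stab_count_def by (rule bij_betw_same_card)
qed

lemma stab_count_pos:
  assumes "finite_gset G X" "p \<in> fst X"
  shows "stab_count G X (stabilizer G (snd X) p) > 0"
  using assms by (auto simp: stab_count_def finite_gset_def card_gt_0_iff)

lemma stab_count_posD: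
  assumes "stab_count G X H > 0"
  obtains p where "p \<in> fst X" "stabilizer G (snd X) p = H"
  using assms by (auto simp: stab_count_def card_gt_0_iff)

section \<open>Cutting a G-set into an orbit and its complement\<close>

definition gset_restrict :: "('a, 'x) gset \<Rightarrow> 'x set \<Rightarrow> ('a, 'x) gset" where
  "gset_restrict X A = (A, \<lambda>g. restrict (snd X g) A)"

lemma (in group) finite_gset_restrict:
  assumes "finite_gset G X" "A \<subseteq> fst X"
    and "\<And>g p. g \<in> carrier G \<Longrightarrow> p \<in> A \<Longrightarrow> snd X g p \<in> A"
  shows "finite_gset G (gset_restrict X A)"
proof -
  interpret group_action G "fst X" "snd X" using assms by (simp add: finite_gset_def)
  have "group_action G A (\<lambda>g. restrict (snd X g) A)"
    using assms(2,3) by (intro group_actionI) (auto simp: action_one composition_rule subset_iff)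
  then show ?thesis
    using assms finite_subset by (auto simp: finite_gset_def gset_restrict_def)
qed

lemma gset_iso_split:
  assumes "A \<subseteq> fst X"
    and "\<And>g p. g \<in> carrier G \<Longrightarrow> p \<in> A \<Longrightarrow> snd X g p \<in> A"
    and "\<And>g p. g \<in> carrier G \<Longrightarrow> p \<in> fst X - A \<Longrightarrow> snd X g p \<in> fst X - A"
  shows "gset_iso G (gset_sum (gset_restrict X A) (gset_restrict X (fst X - A))) X"
proof -
  have "bij_betw (case_sum id id) (A <+> (fst X - A)) (fst X)"
    using assms(1)
    by (intro bij_betw_byWitness[where f' = "\<lambda>p. if p \<in> A then Inl p else Inr p"]) auto
  then show ?thesis
    unfolding gset_iso_def
    using assms by (intro exI[of _ "case_sum id id"]) (auto simp: gset_sum_def gset_restrict_def)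
qed

context group_action
begin

lemma orbit_subset: "p \<in> E \<Longrightarrow> orbit G \<phi> p \<subseteq> E"
  by (auto simp: orbit_def action_closed)

lemma orbit_closed:
  assumes "p \<in> E" "g \<in> carrier G" "q \<in> orbit G \<phi> p"
  shows "\<phi> g q \<in> orbit G \<phi> p"
proof -
  interpret group G using group_hom group_hom.axioms(1) by auto
  show ?thesis
    using assms by (auto simp: orbit_def composition_rule[symmetric])
qed

lemma orbit_compl_closed:
  assumes "p \<in> E" "g \<in> carrier G" "q \<in> E - orbit G \<phi> p"
  shows "\<phi> g q \<in> E - orbit G \<phi> p"
proof -
  interpret group G using group_hom group_hom.axioms(1) by auto
  show ?thesis
    using assms orbit_closed[OF assms(1), of "inv g" "\<phi> g q"] action_closed
    by (auto simp: action_inv_cancel)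
qed

end

text \<open>The isomorphism sends \<open>g p\<close> to \<open>g q\<close>. Whether \<open>g\<close>
  and \<open>h\<close> agree at the base point depends only on its stabilizer, which is the same on
  both sides.\<close>

lemma gset_iso_transitive:
  assumes X: "group_action G (fst X) (snd X)" and Y: "group_action G (fst Y) (snd Y)"
    and p: "p \<in> fst X" "fst X = orbit G (snd X) p"
    and q: "q \<in> fst Y" "fst Y = orbit G (snd Y) q"
    and eq: "stabilizer G (snd X) p = stabilizer G (snd Y) q"
  shows "gset_iso G X Y"
proof -
  interpret X: group_action G "fst X" "snd X" by (rule X)
  interpret Y: group_action G "fst Y" "snd Y" by (rule Y)
  interpret group G using X.group_hom group_hom.axioms(1) by auto
  have same: "snd X g p = snd X h p \<longleftrightarrow> snd Y g q = snd Y h q"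
    if "g \<in> carrier G" "h \<in> carrier G" for g h
    using that X.action_eq_iff[OF that p(1)] Y.action_eq_iff[OF that q(1)] eq by simp
  \<comment> \<open>Any group element carrying \<open>p\<close> to \<open>x\<close> may be used; by
    \<open>same\<close> the choice does not affect the value.\<close>
  define f where "f x = snd Y (SOME g. g \<in> carrier G \<and> snd X g p = x) q" for x
  have f: "f (snd X g p) = snd Y g q" if g: "g \<in> carrier G" for g
  proof -
    have "(SOME h. h \<in> carrier G \<and> snd X h p = snd X g p) \<in> carrier G \<and>
        snd X (SOME h. h \<in> carrier G \<and> snd X h p = snd X g p) p = snd X g p"
      using g by (intro someI[of "\<lambda>h. h \<in> carrier G \<and> snd X h p = snd X g p"]) simp
    then show ?thesis
      unfolding f_def using same g by blast
  qed
  have X_def: "fst X = (\<lambda>g. snd X g p) ` carrier G" and Y_def: "fst Y = (\<lambda>g. snd Y g q) ` carrier G"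
    using p(2) q(2) by (auto simp: orbit_def)
  have "inj_on f (fst X)"
    unfolding X_def inj_on_def using f same by auto
  moreover have "f ` fst X = fst Y"
    unfolding X_def Y_def image_image using f by simp
  moreover have "f (snd X g x) = snd Y g (f x)" if g: "g \<in> carrier G" and "x \<in> fst X" for g x
  proof -
    obtain h where "h \<in> carrier G" "x = snd X h p"
      using \<open>x \<in> fst X\<close> unfolding X_def by blast
    then show ?thesis
      using g f p q by (simp add: X.composition_rule[symmetric] Y.composition_rule[symmetric])
  qed
  ultimately show ?thesis
    unfolding gset_iso_def bij_betw_def by blast
qed

lemma gset_restrict_orbit:
  assumes "group_action G (fst X) (snd X)" "p \<in> fst X"
  defines "Z \<equiv> gset_restrict X (orbit G (snd X) p)"
  shows "p \<in> fst Z" "fst Z = orbit G (snd Z) p" "stabilizer G (snd Z) p = stabilizer G (snd X) p"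
proof -
  interpret group_action G "fst X" "snd X" by fact
  have p: "p \<in> orbit G (snd X) p" using assms orbit_refl by blast
  then show "p \<in> fst Z" "stabilizer G (snd Z) p = stabilizer G (snd X) p"
    by (auto simp: Z_def gset_restrict_def stabilizer_def)
  have "orbit G (\<lambda>g. restrict (snd X g) (orbit G (snd X) p)) p = orbit G (snd X) p"
    using p unfolding orbit_def[of G "\<lambda>g. restrict _ _"] by (simp add: orbit_def)
  then show "fst Z = orbit G (snd Z) p"
    by (simp add: Z_def gset_restrict_def)
qed

context group
begin

text \<open>The induction package on the number of points. It serves twice: to compare two G-sets
  and to expand one in the basis.\<close>

lemma remove_orbit:
  assumes X: "finite_gset G X" and p: "p \<in> fst X"
  defines "A \<equiv> orbit G (snd X) p"
  shows "finite_gset G (gset_restrict X A)" "finite_gset G (gset_restrict X (fst X - A))"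
    and "gset_iso G (gset_sum (gset_restrict X A) (gset_restrict X (fst X - A))) X"
    and "card (fst (gset_restrict X (fst X - A))) < card (fst X)"
    and "stab_count G X H = stab_count G (gset_restrict X A) H + stab_count G (gset_restrict X (fst X - A)) H"
proof -
  interpret group_action G "fst X" "snd X" using X by (simp add: finite_gset_def)
  have A: "A \<subseteq> fst X" "p \<in> A"
    using p orbit_subset orbit_refl by (auto simp: A_def)
  have cl: "\<And>g q. g \<in> carrier G \<Longrightarrow> q \<in> A \<Longrightarrow> snd X g q \<in> A"
      "\<And>g q. g \<in> carrier G \<Longrightarrow> q \<in> fst X - A \<Longrightarrow> snd X g q \<in> fst X - A"
    using orbit_closed[OF p] orbit_compl_closed[OF p] unfolding A_def by blast+
  show 1: "finite_gset G (gset_restrict X A)" "finite_gset G (gset_restrict X (fst X - A))"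
    using X A cl by (auto intro!: finite_gset_restrict)
  show 2: "gset_iso G (gset_sum (gset_restrict X A) (gset_restrict X (fst X - A))) X"
    using A cl by (intro gset_iso_split) auto
  show "card (fst (gset_restrict X (fst X - A))) < card (fst X)"
    using X A by (auto simp: gset_restrict_def finite_gset_def intro!: psubset_card_mono)
  show "stab_count G X H = stab_count G (gset_restrict X A) H + stab_count G (gset_restrict X (fst X - A)) H"
    using stab_count_iso[OF finite_gset_sum[OF 1] 2, of H] stab_count_sum[OF 1] by simp
qed

text \<open>Whatever orbit is taken from \<open>X\<close>, \<open>Y\<close> contains an isomorphic
  one, and removing both keeps the counts equal. As a consequence disjoint sums can be cancelled up
  to isomorphism.\<close>

lemma gset_iso_if_stab_count_eq:
  assumes "finite_gset G X" "finite_gset G Y" "\<And>H. stab_count G X H = stab_count G Y H"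
  shows "gset_iso G X Y"
  using assms
proof (induction "card (fst X)" arbitrary: X Y rule: less_induct)
  case less
  show ?case
  proof (cases "fst X = {}")
    case True
    then have "stab_count G Y H = 0" for H
      using less.prems(3)[of H] by (simp add: stab_count_def)
    \<comment> \<open>Every point of \<open>Y\<close> contributes to the count at its own
      stabilizer, so vanishing counts leave no point.\<close>
    then have "fst Y = {}"
      using stab_count_pos[OF less.prems(2)] by fastforce
    with True show ?thesis by (simp add: gset_iso_def bij_betw_def)
  next
    case False
    then obtain p where p: "p \<in> fst X" by blast
    \<comment> \<open>\<open>p\<close> makes the count of \<open>X\<close> positive at its
      stabilizer, so \<open>Y\<close> has a point \<open>q\<close> with literally the same
      stabilizer, not just a conjugate one.\<close>
    then have "stab_count G Y (stabilizer G (snd X) p) > 0"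
      using less.prems stab_count_pos by metis
    then obtain q where q: "q \<in> fst Y" "stabilizer G (snd Y) q = stabilizer G (snd X) p"
      by (rule stab_count_posD)
    let ?A = "gset_restrict X (orbit G (snd X) p)"
    let ?B = "gset_restrict Y (orbit G (snd Y) q)"
    let ?X = "gset_restrict X (fst X - orbit G (snd X) p)"
    let ?Y = "gset_restrict Y (fst Y - orbit G (snd Y) q)"
    note X = remove_orbit[OF less.prems(1) p]
    note Y = remove_orbit[OF less.prems(2) q(1)]
    have actX: "group_action G (fst X) (snd X)" and actY: "group_action G (fst Y) (snd Y)"
      using less.prems by (auto simp: finite_gset_def)
    have AB: "gset_iso G ?A ?B"
      using gset_restrict_orbit[OF actX p] gset_restrict_orbit[OF actY q(1)] q(2) X(1) Y(1)
      by (intro gset_iso_transitive[where p = p and q = q]) (auto simp: finite_gset_def)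
    have "stab_count G ?X H = stab_count G ?Y H" for H
      using less.prems(3)[of H] X(5)[of H] Y(5)[of H] stab_count_iso[OF X(1) AB, of H] by simp
    then have "gset_iso G ?X ?Y"
      by (intro less.hyps X Y)
    then have "gset_iso G (gset_sum ?A ?X) (gset_sum ?B ?Y)"
      using AB X Y by (intro gset_iso_sum)
    then show ?thesis
      by (rule gset_iso_trans[OF gset_iso_sym[OF finite_gset_sum[OF X(1,2)] X(3)] gset_iso_trans[OF _ Y(3)]])
  qed
qed

end

section \<open>The additive group of the Burnside ring\<close>

definition stab_diff :: "('a, 'b) monoid_scheme \<Rightarrow> ('a, 'x) gset \<Rightarrow> ('a, 'y) gset \<Rightarrow> 'a set \<Rightarrow> int" where
  "stab_diff G X Y H = int (stab_count G X H) - int (stab_count G Y H)"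

text \<open>Not the classical mark \<open>|X^H|\<close>, but its analogue for exact stabilizers. The
  choice is harmless on ring elements, since all pairs in one class have the same
  \<open>stab_diff\<close>.\<close>

definition mark :: "('a, 'b) monoid_scheme \<Rightarrow> 'a burnside \<Rightarrow> 'a set \<Rightarrow> int" where
  "mark G x = (case SOME z. z \<in> x of (P, Q) \<Rightarrow> stab_diff G P Q)"

section \<open>Grothendieck classes as integer functions on subgroups\<close>

context group
begin

text \<open>This removes the auxiliary \<open>Z\<close> of the Grothendieck construction: from here
  on, belonging to a class is an equation between integer functions.\<close>

lemma burnside_diff_eq:
  assumes "finite_gset G X" "finite_gset G Y"
  shows "burnside_diff G X Y =
    {(P, Q). finite_gset G P \<and> finite_gset G Q \<and> stab_diff G P Q = stab_diff G X Y}"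
proof -
  have "(\<exists>Z :: ('a, nat) gset. finite_gset G Z \<and>
           gset_iso G (gset_sum (gset_sum P Y) Z) (gset_sum (gset_sum X Q) Z)) \<longleftrightarrow>
        stab_diff G P Q = stab_diff G X Y" (is "?L \<longleftrightarrow> ?R")
    if P: "finite_gset G P" and Q: "finite_gset G Q" for P Q :: "('a, nat) gset"
  proof
    assume ?L
    then obtain Z :: "('a, nat) gset" where Z: "finite_gset G Z"
        "gset_iso G (gset_sum (gset_sum P Y) Z) (gset_sum (gset_sum X Q) Z)" by blast
    have "stab_count G (gset_sum (gset_sum P Y) Z) H = stab_count G (gset_sum (gset_sum X Q) Z) H" for H
      using Z assms P Q by (intro stab_count_iso finite_gset_sum)
    \<comment> \<open>The contribution of \<open>Z\<close> is a natural number on both sides and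
      cancels.\<close>
    then have "stab_count G P H + stab_count G Y H = stab_count G X H + stab_count G Q H" for H
      using Z assms P Q by (simp add: stab_count_sum finite_gset_sum)
    then show ?R
      unfolding stab_diff_def fun_eq_iff by (smt (verit) of_nat_add)
  next
    assume R: ?R
    have "stab_count G P H + stab_count G Y H = stab_count G X H + stab_count G Q H" for H
      using fun_cong[OF R, of H] by (simp add: stab_diff_def)
    \<comment> \<open>Since counts determine a finite G-set, the empty set serves as
      \<open>Z\<close>.\<close>
    then have "gset_iso G (gset_sum (gset_sum P Y) gset_empty) (gset_sum (gset_sum X Q) gset_empty)"
      using assms P Q
      by (intro gset_iso_if_stab_count_eq)
        (simp_all add: stab_count_sum finite_gset_sum finite_gset_empty)
    then show ?L
      using finite_gset_empty by blast
  qed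
  then show ?thesis
    unfolding burnside_diff_def by blast
qed

lemma burnside_diff_nat_copy:
  assumes "finite_gset G X" "finite_gset G Y"
  obtains P Q :: "('a, nat) gset"
  where "finite_gset G P" "finite_gset G Q" "stab_diff G P Q = stab_diff G X Y"
    "burnside_diff G X Y = burnside_diff G P Q"
proof -
  obtain P Q :: "('a, nat) gset" where
    PQ: "finite_gset G P" "finite_gset G Q" "gset_iso G X P" "gset_iso G Y Q"
    using gset_nat_copy[OF assms(1)] gset_nat_copy[OF assms(2)] by metis
  then have "stab_diff G P Q = stab_diff G X Y"
    using stab_count_iso[OF assms(1) PQ(3)] stab_count_iso[OF assms(2) PQ(4)]
    by (simp add: stab_diff_def fun_eq_iff)
  with PQ that assms show thesis
    by (simp add: burnside_diff_eq)
qed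

lemma mark_burnside_diff:
  assumes "finite_gset G X" "finite_gset G Y"
  shows "mark G (burnside_diff G X Y) = stab_diff G X Y"
proof -
  obtain P Q :: "('a, nat) gset"
    where "finite_gset G P" "finite_gset G Q" "stab_diff G P Q = stab_diff G X Y"
    using burnside_diff_nat_copy[OF assms] by metis
  \<comment> \<open>The class is inhabited, so the \<open>SOME\<close> in \<open>mark\<close> picks
    a genuine member.\<close>
  then have "(P, Q) \<in> burnside_diff G X Y"
    using assms by (simp add: burnside_diff_eq)
  then have "(SOME z. z \<in> burnside_diff G X Y) \<in> burnside_diff G X Y"
    by (rule someI)
  then show ?thesis
    using assms by (auto simp: mark_def burnside_diff_eq split: prod.splits)
qed

lemma burnside_diff_in_carrier:
  assumes "finite_gset G X" "finite_gset G Y"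
  shows "burnside_diff G X Y \<in> carrier (burnside_ring G)"
proof -
  obtain P Q :: "('a, nat) gset" where "finite_gset G P" "finite_gset G Q"
      "burnside_diff G X Y = burnside_diff G P Q"
    using assms by (rule burnside_diff_nat_copy)
  then show ?thesis
    unfolding burnside_ring_def partial_object.simps by blast
qed

lemma in_carrierE:
  assumes "x \<in> carrier (burnside_ring G)"
  obtains P Q :: "('a, nat) gset" where "finite_gset G P" "finite_gset G Q"
    "x = burnside_diff G P Q" "mark G x = stab_diff G P Q"
proof -
  obtain P Q :: "('a, nat) gset" where "finite_gset G P" "finite_gset G Q" "x = burnside_diff G P Q"
    using assms unfolding burnside_ring_def by auto
  then show thesis
    using that mark_burnside_diff by blast
qed

text \<open>A ring element is the full set of pairs with a given difference of counts, so it can be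
  recovered from its mark. This is the injectivity behind \<open>mark_eqI\<close>.\<close>

lemma in_carrier_eq:
  assumes "x \<in> carrier (burnside_ring G)"
  shows "x = {(P, Q). finite_gset G P \<and> finite_gset G Q \<and> stab_diff G P Q = mark G x}"
  using assms by (elim in_carrierE) (simp add: burnside_diff_eq)

lemma mark_eqI:
  assumes "x \<in> carrier (burnside_ring G)" "y \<in> carrier (burnside_ring G)"
    and "\<And>H. mark G x H = mark G y H"
  shows "x = y"
proof -
  have "mark G x = mark G y" using assms(3) by (rule ext)
  then show ?thesis
    using in_carrier_eq[OF assms(1)] in_carrier_eq[OF assms(2)] by simp
qed

lemma stab_count_not_subgroup:
  assumes "finite_gset G X" "\<not> subgroup H G"
  shows "stab_count G X H = 0"
proof -
  interpret group_action G "fst X" "snd X" using assms(1) by (simp add: finite_gset_def)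
  have "{p \<in> fst X. stabilizer G (snd X) p = H} = {}"
    using assms(2) stabilizer_subgroup by auto
  then show ?thesis by (simp only: stab_count_def card.empty)
qed

text \<open>Stabilizers are subgroups, so both marks vanish at every other set.\<close>

lemma mark_eq_subgroupI:
  assumes "x \<in> carrier (burnside_ring G)" "y \<in> carrier (burnside_ring G)"
    and "\<And>H. subgroup H G \<Longrightarrow> mark G x H = mark G y H"
  shows "x = y"
proof (rule mark_eqI[OF assms(1,2)])
  have "mark G z H = 0" if "z \<in> carrier (burnside_ring G)" "\<not> subgroup H G" for z H
    using that(1) by (rule in_carrierE) (simp add: stab_diff_def stab_count_not_subgroup that(2))
  then show "mark G x H = mark G y H" for H
    using assms by (cases "subgroup H G") simp_all
qed

section \<open>Addition and integer multiples\<close>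

text \<open>Collapses the unions by which addition and inflation are defined: \<open>x\<close> is
  nonempty, so a union of equal sets is that set.\<close>

lemma UN_burnside_diff:
  assumes "x \<in> carrier (burnside_ring G)"
    and "\<And>P Q. finite_gset G P \<Longrightarrow> finite_gset G Q \<Longrightarrow> stab_diff G P Q = mark G x \<Longrightarrow> F P Q = z"
  shows "(\<Union>(P, Q)\<in>x. F P Q) = z"
proof -
  obtain P Q :: "('a, nat) gset" where "finite_gset G P" "finite_gset G Q" "x = burnside_diff G P Q" "mark G x = stab_diff G P Q"
    using assms(1) by (rule in_carrierE)
  then have "(P, Q) \<in> x" by (simp add: burnside_diff_eq)
  moreover have "F P Q = z" if "(P, Q) \<in> x" for P Q
    using that in_carrier_eq[OF assms(1)] assms(2) by blast
  ultimately show ?thesis by blast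
qed

lemma burnside_diff_cong:
  assumes "finite_gset G X" "finite_gset G Y" "finite_gset G X'" "finite_gset G Y'"
    and "stab_diff G X Y = stab_diff G X' Y'"
  shows "burnside_diff G X Y = burnside_diff G X' Y'"
  using assms by (simp add: burnside_diff_eq)

lemma stab_diff_sum:
  assumes "finite_gset G X" "finite_gset G Y" "finite_gset G X'" "finite_gset G Y'"
  shows "stab_diff G (gset_sum X X') (gset_sum Y Y') = (\<lambda>H. stab_diff G X Y H + stab_diff G X' Y' H)"
  using assms by (simp add: stab_diff_def stab_count_sum fun_eq_iff)

lemma burnside_add:
  assumes x: "x \<in> carrier (burnside_ring G)" and y: "y \<in> carrier (burnside_ring G)"
  shows "x \<oplus>\<^bsub>burnside_ring G\<^esub> y \<in> carrier (burnside_ring G)"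
    and "mark G (x \<oplus>\<^bsub>burnside_ring G\<^esub> y) H = mark G x H + mark G y H"
proof -
  obtain P Q :: "('a, nat) gset" where P: "finite_gset G P" "finite_gset G Q" "mark G x = stab_diff G P Q"
    using x by (rule in_carrierE)
  obtain P' Q' :: "('a, nat) gset" where P': "finite_gset G P'" "finite_gset G Q'" "mark G y = stab_diff G P' Q'"
    using y by (rule in_carrierE)
  let ?z = "burnside_diff G (gset_sum P P') (gset_sum Q Q')"
  have z: "?z \<in> carrier (burnside_ring G)"
    by (intro burnside_diff_in_carrier finite_gset_sum P P')
  have "x \<oplus>\<^bsub>burnside_ring G\<^esub> y =
      (\<Union>(X, Y)\<in>x. \<Union>(X', Y')\<in>y. burnside_diff G (gset_sum X X') (gset_sum Y Y'))"
    by (simp add: burnside_ring_def)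
  also have "\<dots> = ?z"
    using x y z P P'
    by (intro UN_burnside_diff burnside_diff_cong) (simp_all add: finite_gset_sum stab_diff_sum)
  finally have *: "x \<oplus>\<^bsub>burnside_ring G\<^esub> y = ?z" .
  show "x \<oplus>\<^bsub>burnside_ring G\<^esub> y \<in> carrier (burnside_ring G)"
    using * z by simp
  show "mark G (x \<oplus>\<^bsub>burnside_ring G\<^esub> y) H = mark G x H + mark G y H"
    unfolding * using P P' by (simp add: mark_burnside_diff finite_gset_sum stab_diff_sum)
qed

lemma burnside_zero:
  "\<zero>\<^bsub>burnside_ring G\<^esub> \<in> carrier (burnside_ring G)" "mark G \<zero>\<^bsub>burnside_ring G\<^esub> H = 0"
proof -
  have z: "\<zero>\<^bsub>burnside_ring G\<^esub> = burnside_diff G gset_empty gset_empty"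
    by (simp add: burnside_ring_def burnside_class_def)
  show "\<zero>\<^bsub>burnside_ring G\<^esub> \<in> carrier (burnside_ring G)" "mark G \<zero>\<^bsub>burnside_ring G\<^esub> H = 0"
    unfolding z
    by (simp_all add: burnside_diff_in_carrier mark_burnside_diff finite_gset_empty stab_diff_def)
qed

lemma mark_burnside_class:
  assumes "finite_gset G X"
  shows "burnside_class G X \<in> carrier (burnside_ring G)"
    and "mark G (burnside_class G X) H = int (stab_count G X H)"
  unfolding burnside_class_def using assms
  by (simp_all add: burnside_diff_in_carrier mark_burnside_diff finite_gset_empty stab_diff_def)

text \<open>Through \<open>mark_eqI\<close> every group law becomes the same law for integers at
  each subgroup.\<close>

lemma abelian_group_burnside: "abelian_group (burnside_ring G)"
proof (rule abelian_groupI)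
  fix x assume x: "x \<in> carrier (burnside_ring G)"
  then obtain P Q :: "('a, nat) gset" where P: "finite_gset G P" "finite_gset G Q" "mark G x = stab_diff G P Q"
    by (rule in_carrierE)
  \<comment> \<open>The negative of \<open>[P] - [Q]\<close> is \<open>[Q] - [P]\<close>.\<close>
  have "burnside_diff G Q P \<in> carrier (burnside_ring G)"
    using P by (simp add: burnside_diff_in_carrier)
  moreover from this have "burnside_diff G Q P \<oplus>\<^bsub>burnside_ring G\<^esub> x = \<zero>\<^bsub>burnside_ring G\<^esub>"
    using x P by (intro mark_eqI) (simp_all add: burnside_add burnside_zero mark_burnside_diff stab_diff_def)
  ultimately show "\<exists>y\<in>carrier (burnside_ring G). y \<oplus>\<^bsub>burnside_ring G\<^esub> x = \<zero>\<^bsub>burnside_ring G\<^esub>"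
    by blast
qed ((rule mark_eqI)?; simp add: burnside_add burnside_zero)+

lemma mark_uminus:
  assumes x: "x \<in> carrier (burnside_ring G)"
  shows "mark G (\<ominus>\<^bsub>burnside_ring G\<^esub> x) H = - mark G x H"
proof -
  interpret R: abelian_group "burnside_ring G" by (rule abelian_group_burnside)
  have "mark G (x \<oplus>\<^bsub>burnside_ring G\<^esub> \<ominus>\<^bsub>burnside_ring G\<^esub> x) H = 0"
    using x by (simp add: R.r_neg burnside_zero)
  then show ?thesis
    using x burnside_add(2)[OF x R.a_inv_closed[OF x], of H] by linarith
qed

lemma burnside_int_mult:
  fixes k :: int
  assumes x: "x \<in> carrier (burnside_ring G)"
  shows "[k] \<cdot>\<^bsub>burnside_ring G\<^esub> x \<in> carrier (burnside_ring G)"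
    and "mark G ([k] \<cdot>\<^bsub>burnside_ring G\<^esub> x) H = k * mark G x H"
proof -
  interpret R: abelian_group "burnside_ring G" by (rule abelian_group_burnside)
  show "[k] \<cdot>\<^bsub>burnside_ring G\<^esub> x \<in> carrier (burnside_ring G)"
    using R.add.int_pow_closed[OF x] by simp
  have nat: "mark G ([n] \<cdot>\<^bsub>burnside_ring G\<^esub> x) H = int n * mark G x H" for n :: nat
  proof (induction n)
    case 0
    show ?case by (simp add: burnside_zero)
  next
    case (Suc n)
    have "[Suc n] \<cdot>\<^bsub>burnside_ring G\<^esub> x = [n] \<cdot>\<^bsub>burnside_ring G\<^esub> x \<oplus>\<^bsub>burnside_ring G\<^esub> x"
      by (rule R.add.nat_pow_Suc)
    then show ?case
      using Suc burnside_add(2)[OF R.add.nat_pow_closed[OF x, of n] x] by (simp add: algebra_simps)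
  qed
  show "mark G ([k] \<cdot>\<^bsub>burnside_ring G\<^esub> x) H = k * mark G x H"
  proof (cases "k \<ge> 0")
    case True
    then show ?thesis using nat[of "nat k"] by (simp add: add_pow_int_ge)
  next
    case False
    then show ?thesis
      using nat[of "nat (- k)"] mark_uminus[OF R.add.nat_pow_closed[OF x, of "nat (- k)"]]
      by (simp add: add_pow_int_lt)
  qed
qed

lemma mark_finsum:
  assumes "finite A" "\<And>i. i \<in> A \<Longrightarrow> f i \<in> carrier (burnside_ring G)"
  shows "mark G (\<Oplus>\<^bsub>burnside_ring G\<^esub>i\<in>A. f i) H = (\<Sum>i\<in>A. mark G (f i) H)"
proof -
  interpret R: abelian_group "burnside_ring G" by (rule abelian_group_burnside)
  show ?thesis
    using assms
  proof (induction A rule: finite_induct)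
    case (insert i A)
    then show ?case
      using burnside_add(2)[of "f i" "\<Oplus>\<^bsub>burnside_ring G\<^esub>i\<in>A. f i"] by simp
  qed (simp add: burnside_zero)
qed

text \<open>The common shape of the expansion in \<open>burnside_coeffs\<close> and of the sum
  defining \<open>core_compression\<close>.\<close>

lemma burnside_lincomb:
  fixes a :: "'i \<Rightarrow> int"
  assumes "finite A" "\<And>i. i \<in> A \<Longrightarrow> finite_gset G (X i)"
  defines "x \<equiv> \<Oplus>\<^bsub>burnside_ring G\<^esub>i\<in>A. [a i] \<cdot>\<^bsub>burnside_ring G\<^esub> burnside_class G (X i)"
  shows "x \<in> carrier (burnside_ring G)"
    and "mark G x H = (\<Sum>i\<in>A. a i * int (stab_count G (X i) H))"
proof -
  interpret R: abelian_group "burnside_ring G" by (rule abelian_group_burnside)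
  show "x \<in> carrier (burnside_ring G)"
    unfolding x_def using assms by (intro R.finsum_closed) (simp add: burnside_int_mult mark_burnside_class)
  show "mark G x H = (\<Sum>i\<in>A. a i * int (stab_count G (X i) H))"
    unfolding x_def using assms by (simp add: mark_finsum burnside_int_mult mark_burnside_class)
qed

end

section \<open>Conjugacy classes and coefficients\<close>

definition conjugate :: "('a, 'b) monoid_scheme \<Rightarrow> 'a set \<Rightarrow> 'a set \<Rightarrow> bool" where
  "conjugate G H K \<longleftrightarrow> (\<exists>g\<in>carrier G. K = g <#\<^bsub>G\<^esub> H #>\<^bsub>G\<^esub> inv\<^bsub>G\<^esub> g)"

text \<open>The divisor is the index of \<open>H\<close> in its normalizer, that is, the number of
  points of \<open>G/H\<close> with stabilizer \<open>H\<close>. Unlike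
  \<open>burnside_coeffs\<close>, this is meaningful at subgroups that are not chosen
  representatives.\<close>

definition basis_coeff :: "('a, 'b) monoid_scheme \<Rightarrow> 'a burnside \<Rightarrow> 'a set \<Rightarrow> int" where
  "basis_coeff G x H = mark G x H div int (stab_count G (coset_gset G H) H)"

section \<open>Conjugacy of subgroups and representatives\<close>

context group
begin

text \<open>Conjugacy inherits the laws of an equivalence relation from the orbits of the
  conjugation action.\<close>

lemma conjugate_iff_orbit:
  assumes "subgroup H G"
  shows "conjugate G H K \<longleftrightarrow> K \<in> orbit G (\<lambda>g. \<lambda>H\<in>{H. subgroup H G}. g <# H #> inv g) H"
  using assms by (auto simp: conjugate_def orbit_def)

lemma conjugate_subgroup: "subgroup H G \<Longrightarrow> conjugate G H K \<Longrightarrow> subgroup K G"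
  by (auto simp: conjugate_def subgroup_conjugation_is_surj2)

lemma conjugate_refl: "subgroup H G \<Longrightarrow> conjugate G H H"
  using group_action.orbit_refl[OF action_by_conjugation_on_subgroups_set]
  by (simp add: conjugate_iff_orbit)

lemma conjugate_sym: "subgroup H G \<Longrightarrow> conjugate G H K \<Longrightarrow> conjugate G K H"
  using group_action.orbit_sym[OF action_by_conjugation_on_subgroups_set, of H K] conjugate_subgroup[of H K]
  by (simp add: conjugate_iff_orbit)

lemma conjugate_trans:
  "subgroup H G \<Longrightarrow> conjugate G H K \<Longrightarrow> conjugate G K L \<Longrightarrow> conjugate G H L"
  using group_action.orbit_trans[OF action_by_conjugation_on_subgroups_set, of H K L]
    conjugate_subgroup[of H K] conjugate_subgroup[of K L]
  by (simp add: conjugate_iff_orbit)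

lemma conj_classes_some:
  assumes "C \<in> conj_classes G"
  shows "(SOME H. H \<in> C) \<in> C" "subgroup (SOME H. H \<in> C) G"
proof -
  let ?\<phi> = "\<lambda>g. \<lambda>H\<in>{H. subgroup H G}. g <# H #> inv g"
  interpret conj: group_action G "{H. subgroup H G}" ?\<phi>
    by (rule action_by_conjugation_on_subgroups_set)
  obtain H where H: "subgroup H G" "C = orbit G ?\<phi> H"
    using assms by (auto simp: conj_classes_def orbits_def)
  then have "H \<in> C" using conj.orbit_refl by simp
  then show *: "(SOME H. H \<in> C) \<in> C" by (rule someI)
  moreover have "C \<subseteq> {H. subgroup H G}"
    using H conj.orbit_subset by simp
  ultimately show "subgroup (SOME H. H \<in> C) G" by blast
qed

lemma subgroup_reps_subgroup: "H \<in> subgroup_reps G \<Longrightarrow> subgroup H G"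
  using conj_classes_some by (auto simp: subgroup_reps_def)

lemma finite_subgroup_reps:
  assumes "finite (carrier G)"
  shows "finite (subgroup_reps G)"
proof (rule finite_subset)
  show "subgroup_reps G \<subseteq> Pow (carrier G)"
    using subgroup_reps_subgroup subgroup.subset by blast
qed (use assms in simp)

lemma subgroup_reps_exists:
  assumes "subgroup H G"
  obtains K where "K \<in> subgroup_reps G" "conjugate G H K"
proof -
  let ?\<phi> = "\<lambda>g. \<lambda>H\<in>{H. subgroup H G}. g <# H #> inv g"
  have "orbit G ?\<phi> H \<in> conj_classes G"
    using assms by (auto simp: conj_classes_def orbits_def)
  moreover from this have "conjugate G H (SOME K. K \<in> orbit G ?\<phi> H)"
    using conj_classes_some(1) assms by (simp add: conjugate_iff_orbit)
  ultimately show thesis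
    using that by (auto simp: subgroup_reps_def)
qed

lemma subgroup_reps_unique:
  assumes "H \<in> subgroup_reps G" "K \<in> subgroup_reps G" "conjugate G H K"
  shows "H = K"
proof -
  let ?\<phi> = "\<lambda>g. \<lambda>H\<in>{H. subgroup H G}. g <# H #> inv g"
  interpret conj: group_action G "{H. subgroup H G}" ?\<phi>
    by (rule action_by_conjugation_on_subgroups_set)
  obtain C D where C: "C \<in> conj_classes G" "H = (SOME H. H \<in> C)"
      and D: "D \<in> conj_classes G" "K = (SOME H. H \<in> D)"
    using assms by (auto simp: subgroup_reps_def)
  obtain L where L: "subgroup L G" "C = orbit G ?\<phi> L"
    using C by (auto simp: conj_classes_def orbits_def)
  have "conjugate G L H" using conj_classes_some(1)[OF C(1)] C L by (simp add: conjugate_iff_orbit)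
  then have "conjugate G L K" using L assms(3) conjugate_trans by blast
  then have "K \<in> C" using L by (simp add: conjugate_iff_orbit)
  moreover have "K \<in> D" using conj_classes_some(1) D by simp
  \<comment> \<open>Distinct orbits are disjoint, and \<open>K\<close> lies in both.\<close>
  ultimately have "C = D"
    using conj.disjoint_union[of C D] C D by (auto simp: conj_classes_def)
  then show ?thesis using C D by simp
qed

text \<open>Translation by the conjugating element maps one set of points bijectively onto the
  other.\<close>

lemma stab_count_conjugate:
  assumes X: "finite_gset G X" and H: "subgroup H G" and "conjugate G H K"
  shows "stab_count G X K = stab_count G X H"
proof -
  interpret X: group_action G "fst X" "snd X" using X by (simp add: finite_gset_def)
  obtain g where g: "g \<in> carrier G" "K = g <# H #> inv g"
    using assms(3) by (auto simp: conjugate_def)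
  have HK: "inv g <# K #> inv (inv g) = H"
    using subgroup_conjugation_is_surj0[of "inv g" H] g subgroup.subset[OF H] by simp
  have "bij_betw (snd X g) {p \<in> fst X. stabilizer G (snd X) p = H} {p \<in> fst X. stabilizer G (snd X) p = K}"
  proof (rule bij_betw_byWitness[where f' = "snd X (inv g)"])
    show "\<forall>p\<in>{p \<in> fst X. stabilizer G (snd X) p = H}. snd X (inv g) (snd X g p) = p"
      using g X.action_inv_cancel by simp
    show "\<forall>p\<in>{p \<in> fst X. stabilizer G (snd X) p = K}. snd X g (snd X (inv g) p) = p"
      using g X.action_inv_cancel[of "inv g"] by simp
    show "snd X g ` {p \<in> fst X. stabilizer G (snd X) p = H} \<subseteq> {p \<in> fst X. stabilizer G (snd X) p = K}"
      using g by (auto simp: X.stabilizer_action X.action_closed)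
    show "snd X (inv g) ` {p \<in> fst X. stabilizer G (snd X) p = K} \<subseteq> {p \<in> fst X. stabilizer G (snd X) p = H}"
      using g HK X.stabilizer_action[of "inv g"] by (auto simp: X.action_closed)
  qed
  then show ?thesis
    unfolding stab_count_def by (rule bij_betw_same_card[symmetric])
qed

lemma mark_conjugate:
  assumes "x \<in> carrier (burnside_ring G)" "subgroup H G" "conjugate G H K"
  shows "mark G x K = mark G x H"
  using assms(1) by (rule in_carrierE) (simp add: stab_diff_def stab_count_conjugate[OF _ assms(2,3)])

section \<open>Coset spaces\<close>

lemma coset_gset_action:
  assumes H: "subgroup H G"
  shows "group_action G (fst (coset_gset G H)) (snd (coset_gset G H))"
proof (rule group_actionI)
  have mult: "g <# C \<in> lcosets H" if "g \<in> carrier G" "C \<in> lcosets H" for g C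
    using that subgroup.subset[OF H] by (auto simp: LCOSETS_def lcos_m_assoc)
  have C: "C \<subseteq> carrier G" if "C \<in> lcosets H" for C
    using that lcosets_subset_PowG[OF H] by blast
  show "snd (coset_gset G H) (g \<otimes> h) p = snd (coset_gset G H) g (snd (coset_gset G H) h p)"
    if "g \<in> carrier G" "h \<in> carrier G" "p \<in> fst (coset_gset G H)" for g h p
    using that mult C by (simp add: coset_gset_def lcos_m_assoc)
  show "snd (coset_gset G H) g p \<in> fst (coset_gset G H)"
    if "g \<in> carrier G" "p \<in> fst (coset_gset G H)" for g p
    using that mult by (simp add: coset_gset_def)
  show "snd (coset_gset G H) \<one> p = p" if "p \<in> fst (coset_gset G H)" for p
    using that C by (simp add: coset_gset_def lcos_mult_one)
  show "snd (coset_gset G H) g \<in> extensional (fst (coset_gset G H))" if "g \<in> carrier G" for g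
    by (simp add: coset_gset_def)
qed

lemma finite_coset_gset:
  assumes "finite (carrier G)" "subgroup H G"
  shows "finite_gset G (coset_gset G H)"
  using assms coset_gset_action[OF assms(2)]
  by (simp add: finite_gset_def) (simp add: coset_gset_def LCOSETS_def)

lemma coset_gset_base:
  assumes H: "subgroup H G"
  shows "H \<in> fst (coset_gset G H)" "stabilizer G (snd (coset_gset G H)) H = H"
    and "fst (coset_gset G H) = orbit G (snd (coset_gset G H)) H"
proof -
  have "\<one> <# H = H" using H by (simp add: lcos_mult_one subgroup.subset)
  then have HL: "H \<in> lcosets H" unfolding LCOSETS_def by blast
  then show "H \<in> fst (coset_gset G H)" by (simp add: coset_gset_def)
  have act: "snd (coset_gset G H) g H = g <# H" for g
    using HL by (simp add: coset_gset_def)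
  have "g <# H = H \<longleftrightarrow> g \<in> H" if "g \<in> carrier G" for g
    using coset_join3[OF that H] lcos_self[OF that H] by auto
  then have "stabilizer G (snd (coset_gset G H)) H = {g \<in> carrier G. g \<in> H}"
    unfolding stabilizer_def act by (rule Collect_cong[OF conj_cong[OF refl]])
  also have "\<dots> = H"
    using subgroup.subset[OF H] by blast
  finally show "stabilizer G (snd (coset_gset G H)) H = H" .
  show "fst (coset_gset G H) = orbit G (snd (coset_gset G H)) H"
    unfolding orbit_def act by (auto simp: coset_gset_def LCOSETS_def)
qed

text \<open>The orbit-stabilizer theorem, with \<open>p\<close> corresponding to the trivial
  coset.\<close>

lemma gset_iso_coset_gset:
  assumes "group_action G (fst X) (snd X)" "p \<in> fst X" "fst X = orbit G (snd X) p"
  shows "gset_iso G X (coset_gset G (stabilizer G (snd X) p))"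
proof -
  have H: "subgroup (stabilizer G (snd X) p) G"
    using group_action.stabilizer_subgroup[OF assms(1,2)] .
  show ?thesis
    by (rule gset_iso_transitive[OF assms(1) coset_gset_action[OF H] assms(2,3)
        coset_gset_base(1,3)[OF H] coset_gset_base(2)[OF H, symmetric]])
qed

text \<open>Moves the base point of \<open>G/H\<close> from the trivial coset to an arbitrary one.
  This yields the stabilizers of all points.\<close>

lemma coset_gset_stabilizer_orbit:
  assumes H: "subgroup H G" and g: "g \<in> carrier G"
  shows "g <# H \<in> fst (coset_gset G H)"
    and "stabilizer G (snd (coset_gset G H)) (g <# H) = g <# H #> inv g"
    and "fst (coset_gset G H) = orbit G (snd (coset_gset G H)) (g <# H)"
proof -
  interpret X: group_action G "fst (coset_gset G H)" "snd (coset_gset G H)"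
    using H by (rule coset_gset_action)
  note base = coset_gset_base[OF H]
  have gH: "snd (coset_gset G H) g H = g <# H"
    using base(1) by (simp add: coset_gset_def)
  then show 1: "g <# H \<in> fst (coset_gset G H)"
    using X.action_closed[OF g base(1)] by simp
  show "stabilizer G (snd (coset_gset G H)) (g <# H) = g <# H #> inv g"
    using X.stabilizer_action[OF g base(1)] gH base(2) by simp
  have H_orbit: "H \<in> orbit G (snd (coset_gset G H)) (g <# H)"
    by (rule X.orbit_sym[OF base(1) 1 1[unfolded base(3)]])
  show "fst (coset_gset G H) = orbit G (snd (coset_gset G H)) (g <# H)"
  proof (rule subset_antisym[OF subsetI X.orbit_subset[OF 1]])
    fix q assume q: "q \<in> fst (coset_gset G H)"
    show "q \<in> orbit G (snd (coset_gset G H)) (g <# H)"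
      by (rule X.orbit_trans[OF 1 base(1) q H_orbit q[unfolded base(3)]])
  qed
qed

lemma stab_count_coset_gset_pos_iff:
  assumes "finite (carrier G)" and H: "subgroup H G"
  shows "stab_count G (coset_gset G H) K > 0 \<longleftrightarrow> conjugate G H K"
proof
  assume "stab_count G (coset_gset G H) K > 0"
  then obtain p where p: "p \<in> fst (coset_gset G H)" "stabilizer G (snd (coset_gset G H)) p = K"
    by (rule stab_count_posD)
  then obtain g where "g \<in> carrier G" "p = g <# H"
    by (auto simp: coset_gset_def LCOSETS_def)
  then show "conjugate G H K"
    using p coset_gset_stabilizer_orbit[OF H] by (auto simp: conjugate_def)
next
  assume "conjugate G H K"
  then obtain g where g: "g \<in> carrier G" "K = g <# H #> inv g"
    by (auto simp: conjugate_def)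
  then show "stab_count G (coset_gset G H) K > 0"
    using stab_count_pos[OF finite_coset_gset[OF assms] coset_gset_stabilizer_orbit(1)[OF H g(1)]]
    unfolding coset_gset_stabilizer_orbit(2)[OF H g(1)] by simp
qed

text \<open>\<open>G/H\<close> has a point with stabilizer \<open>K\<close>; taken as base point, it
  exhibits the same G-set as \<open>G/K\<close>.\<close>

lemma stab_count_coset_gset_conjugate:
  assumes "finite (carrier G)" and H: "subgroup H G" and "conjugate G H K"
  shows "stab_count G (coset_gset G K) L = stab_count G (coset_gset G H) L"
proof -
  obtain g where g: "g \<in> carrier G" "K = g <# H #> inv g"
    using assms(3) by (auto simp: conjugate_def)
  have "gset_iso G (coset_gset G H) (coset_gset G K)"
    using gset_iso_coset_gset[OF coset_gset_action[OF H] coset_gset_stabilizer_orbit(1,3)[OF H g(1)]]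
    unfolding coset_gset_stabilizer_orbit(2)[OF H g(1)] g(2) .
  then show ?thesis
    by (rule stab_count_iso[OF finite_coset_gset[OF assms(1) H], symmetric])
qed

section \<open>Existence and uniqueness of coefficients\<close>

text \<open>The spanning half of the basis property, at the level of counts. One family
  \<open>a\<close> has to serve all \<open>H\<close> at once, hence the order of the
  quantifiers.\<close>

lemma stab_count_eq_lincomb:
  assumes fin: "finite (carrier G)" and "finite_gset G X"
  shows "\<exists>a :: 'a set \<Rightarrow> int. \<forall>H. int (stab_count G X H) =
    (\<Sum>K\<in>subgroup_reps G. a K * int (stab_count G (coset_gset G K) H))"
  using assms(2)
proof (induction "card (fst X)" arbitrary: X rule: less_induct)
  case less
  show ?case
  proof (cases "fst X = {}")
    case True
    then show ?thesis
      by (intro exI[of _ "\<lambda>_. 0"]) (simp add: stab_count_def)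
  next
    case False
    then obtain p where p: "p \<in> fst X" by blast
    have act: "group_action G (fst X) (snd X)"
      using less.prems by (simp add: finite_gset_def)
    let ?A = "gset_restrict X (orbit G (snd X) p)"
    let ?X = "gset_restrict X (fst X - orbit G (snd X) p)"
    let ?S = "stabilizer G (snd X) p"
    note X = remove_orbit[OF less.prems p]
    obtain a :: "'a set \<Rightarrow> int" where a: "\<And>H. int (stab_count G ?X H) =
        (\<Sum>K\<in>subgroup_reps G. a K * int (stab_count G (coset_gset G K) H))"
      using less.hyps[OF X(4) X(2)] by blast
    have S: "subgroup ?S G"
      using group_action.stabilizer_subgroup[OF act p] .
    then obtain K where K: "K \<in> subgroup_reps G" "conjugate G ?S K"
      by (rule subgroup_reps_exists)
    have "gset_iso G ?A (coset_gset G ?S)"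
      using gset_iso_coset_gset[OF _ gset_restrict_orbit(1,2)[OF act p]] X(1)
      unfolding gset_restrict_orbit(3)[OF act p] finite_gset_def by blast
    then have A: "stab_count G ?A H = stab_count G (coset_gset G K) H" for H
      using stab_count_iso[OF X(1)] stab_count_coset_gset_conjugate[OF fin S K(2)] by metis
    \<comment> \<open>The removed orbit is a copy of \<open>G/K\<close> with \<open>K\<close> a
      representative, so the coefficient of \<open>K\<close> grows by one.\<close>
    have "int (stab_count G X H) =
        (\<Sum>L\<in>subgroup_reps G. (a L + (if L = K then 1 else 0)) * int (stab_count G (coset_gset G L) H))" for H
    proof -
      have "(\<Sum>L\<in>subgroup_reps G. (if L = K then 1 else 0) * int (stab_count G (coset_gset G L) H)) =
          (\<Sum>L\<in>subgroup_reps G. if L = K then int (stab_count G (coset_gset G K) H) else 0)"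
        by (intro sum.cong) auto
      also have "\<dots> = int (stab_count G (coset_gset G K) H)"
        using K(1) finite_subgroup_reps[OF fin] by simp
      finally have "(\<Sum>L\<in>subgroup_reps G. (if L = K then 1 else 0) * int (stab_count G (coset_gset G L) H)) =
          int (stab_count G (coset_gset G K) H)" .
      then show ?thesis
        using X(5)[of H] A[of H] a[of H] by (simp only: distrib_right sum.distrib of_nat_add add.commute)
    qed
    then show ?thesis by (rule exI[of _ "\<lambda>L. a L + (if L = K then 1 else 0)", OF allI])
  qed
qed

text \<open>Numerator and divisor are each invariant; in the divisor both the coset space and the
  subgroup at which it is counted change.\<close>

lemma basis_coeff_conjugate:
  assumes "finite (carrier G)" "x \<in> carrier (burnside_ring G)" "subgroup H G" "conjugate G H K"
  shows "basis_coeff G x K = basis_coeff G x H"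
  unfolding basis_coeff_def mark_conjugate[OF assms(2,3,4)] stab_count_coset_gset_conjugate[OF assms(1,3,4)]
    stab_count_conjugate[OF finite_coset_gset[OF assms(1,3)] assms(3,4)] ..

text \<open>The independence half: distinct representatives are not conjugate, so evaluation at
  \<open>H\<close> kills every term except \<open>K = H\<close>.\<close>

lemma lincomb_coeff:
  assumes fin: "finite (carrier G)" and H: "H \<in> subgroup_reps G"
    and "mark G x H = (\<Sum>K\<in>subgroup_reps G. a K * int (stab_count G (coset_gset G K) H))"
  shows "a H = basis_coeff G x H"
proof -
  have "stab_count G (coset_gset G K) H = 0" if "K \<in> subgroup_reps G" "K \<noteq> H" for K
    using that H subgroup_reps_unique stab_count_coset_gset_pos_iff[OF fin, of K H] subgroup_reps_subgroup
    by blast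
  then have "mark G x H = (\<Sum>K\<in>subgroup_reps G. if K = H then a H * int (stab_count G (coset_gset G H) H) else 0)"
    unfolding assms(3) by (intro sum.cong) auto
  then have "mark G x H = a H * int (stab_count G (coset_gset G H) H)"
    using H finite_subgroup_reps[OF fin] by simp
  moreover have "stab_count G (coset_gset G H) H > 0"
    using H subgroup_reps_subgroup conjugate_refl stab_count_coset_gset_pos_iff[OF fin] by blast
  ultimately show ?thesis by (simp add: basis_coeff_def)
qed

lemma burnside_coeffs_eq:
  assumes fin: "finite (carrier G)" and x: "x \<in> carrier (burnside_ring G)"
  shows "burnside_coeffs G x = restrict (basis_coeff G x) (subgroup_reps G)"
    and "mark G x H = (\<Sum>K\<in>subgroup_reps G. basis_coeff G x K * int (stab_count G (coset_gset G K) H))"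
proof -
  obtain P Q :: "('a, nat) gset" where P: "finite_gset G P" "finite_gset G Q" "mark G x = stab_diff G P Q"
    using x by (rule in_carrierE)
  obtain a b :: "'a set \<Rightarrow> int"
    where "\<And>H. int (stab_count G P H) = (\<Sum>K\<in>subgroup_reps G. a K * int (stab_count G (coset_gset G K) H))"
      and "\<And>H. int (stab_count G Q H) = (\<Sum>K\<in>subgroup_reps G. b K * int (stab_count G (coset_gset G K) H))"
    using stab_count_eq_lincomb[OF fin P(1)] stab_count_eq_lincomb[OF fin P(2)] by blast
  \<comment> \<open>For \<open>x = [P] - [Q]\<close> the coefficients of \<open>Q\<close> are
    subtracted from those of \<open>P\<close>.\<close>
  then have ab: "mark G x H = (\<Sum>K\<in>subgroup_reps G. (a K - b K) * int (stab_count G (coset_gset G K) H))" for H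
    by (simp add: P stab_diff_def left_diff_distrib sum_subtractf)
  have "a K - b K = basis_coeff G x K" if "K \<in> subgroup_reps G" for K
    using lincomb_coeff[OF fin that ab] .
  then show mark: "mark G x H = (\<Sum>K\<in>subgroup_reps G. basis_coeff G x K * int (stab_count G (coset_gset G K) H))" for H
    unfolding ab by simp
  \<comment> \<open>Turns the expansion in the ring into a condition on the values of
    \<open>a\<close> at representatives. Extensionality fixes the values elsewhere, and the definite
    description is then immediate.\<close>
  have iff: "x = (\<Oplus>\<^bsub>burnside_ring G\<^esub>H\<in>subgroup_reps G.
        [a H] \<cdot>\<^bsub>burnside_ring G\<^esub> burnside_class G (coset_gset G H)) \<longleftrightarrow>
      (\<forall>H\<in>subgroup_reps G. a H = basis_coeff G x H)" (is "x = ?z a \<longleftrightarrow> _") for a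
  proof -
    have z: "?z a \<in> carrier (burnside_ring G)"
        "mark G (?z a) H = (\<Sum>K\<in>subgroup_reps G. a K * int (stab_count G (coset_gset G K) H))" for a :: "'a set \<Rightarrow> int" and H
      by (rule burnside_lincomb[OF finite_subgroup_reps[OF fin]],
          erule finite_coset_gset[OF fin subgroup_reps_subgroup])+
    show ?thesis
    proof
      assume "x = ?z a"
      then have "mark G x H = (\<Sum>K\<in>subgroup_reps G. a K * int (stab_count G (coset_gset G K) H))" for H
        using z(2)[of a H] by metis
      then show "\<forall>H\<in>subgroup_reps G. a H = basis_coeff G x H"
        using lincomb_coeff[OF fin] by blast
    next
      assume "\<forall>H\<in>subgroup_reps G. a H = basis_coeff G x H"
      then show "x = ?z a"
        using z mark x by (intro mark_eqI) simp_all
    qed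
  qed
  show "burnside_coeffs G x = restrict (basis_coeff G x) (subgroup_reps G)"
    unfolding burnside_coeffs_def iff
  proof (rule the_equality)
    fix a assume "a \<in> extensional (subgroup_reps G) \<and> (\<forall>H\<in>subgroup_reps G. a H = basis_coeff G x H)"
    then show "a = restrict (basis_coeff G x) (subgroup_reps G)"
      by (intro extensionalityI[of a "subgroup_reps G"]) simp_all
  qed simp
qed

section \<open>Normal cores\<close>

lemma mem_normal_core_iff:
  assumes "H \<subseteq> carrier G"
  shows "k \<in> normal_core G H \<longleftrightarrow> k \<in> carrier G \<and> (\<forall>g\<in>carrier G. inv g \<otimes> k \<otimes> g \<in> H)"
proof -
  have "k \<in> carrier G" if "k \<in> normal_core G H"
    using that conj_subset[OF one_closed assms] unfolding normal_core_def by blast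
  moreover have "k \<in> normal_core G H \<longleftrightarrow> (\<forall>g\<in>carrier G. inv g \<otimes> k \<otimes> g \<in> H)" if "k \<in> carrier G"
    unfolding normal_core_def using mem_conj_iff[OF _ assms that] by simp
  ultimately show ?thesis by blast
qed

lemma subgroup_normal_core:
  assumes "subgroup H G"
  shows "subgroup (normal_core G H) G"
proof -
  have "normal_core G H = \<Inter> ((\<lambda>g. g <# H #> inv g) ` carrier G)"
    by (simp add: normal_core_def)
  also have "subgroup \<dots> G"
    using assms subgroup_conjugation_is_surj2 one_closed by (intro subgroups_Inter) auto
  finally show ?thesis .
qed

text \<open>Passing to \<open>K\<close> only reindexes the conjugates that are intersected. One
  inclusion suffices, as conjugacy is symmetric.\<close>

lemma normal_core_conjugate:
  assumes H: "subgroup H G" and "conjugate G H K"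
  shows "normal_core G K = normal_core G H"
proof -
  have le: "normal_core G K \<subseteq> normal_core G H" if H: "subgroup H G" and HK: "conjugate G H K" for H K
  proof
    fix k assume k: "k \<in> normal_core G K"
    have sub: "H \<subseteq> carrier G" "K \<subseteq> carrier G"
      using H conjugate_subgroup[OF H HK] subgroup.subset by auto
    obtain g where g: "g \<in> carrier G" "K = g <# H #> inv g"
      using HK by (auto simp: conjugate_def)
    have kc: "k \<in> carrier G" using k sub by (simp add: mem_normal_core_iff)
    have "inv h \<otimes> k \<otimes> h \<in> H" if h: "h \<in> carrier G" for h
    proof -
      \<comment> \<open>The core of \<open>K\<close> is tested at \<open>h\<close> times
        \<open>inv g\<close>: going back from \<open>K\<close> to \<open>H\<close> contributes a
        factor \<open>g\<close> that cancels \<open>inv g\<close>.\<close>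
      have "inv (h \<otimes> inv g) \<otimes> k \<otimes> (h \<otimes> inv g) \<in> K"
        using k h g sub by (simp add: mem_normal_core_iff)
      then have "inv g \<otimes> (inv (h \<otimes> inv g) \<otimes> k \<otimes> (h \<otimes> inv g)) \<otimes> g \<in> H"
        using g h kc sub mem_conj_iff by simp
      also have "inv g \<otimes> (inv (h \<otimes> inv g) \<otimes> k \<otimes> (h \<otimes> inv g)) \<otimes> g = inv h \<otimes> k \<otimes> h"
      proof -
        have "inv g \<otimes> (g \<otimes> z) = z" if "z \<in> carrier G" for z
          using g that by (simp flip: m_assoc)
        then show ?thesis using g h kc by (simp add: inv_mult_group m_assoc)
      qed
      finally show ?thesis .
    qed
    then show "k \<in> normal_core G H"
      using kc sub by (simp add: mem_normal_core_iff)
  qed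
  show ?thesis
    using le[OF assms] le[OF conjugate_subgroup[OF assms] conjugate_sym[OF assms]] by blast
qed

text \<open>Padding with zeros makes the sum range over all representatives, the form that
  \<open>sum_subgroup_reps_FactGroup\<close> can handle.\<close>

lemma core_coeff_eq:
  assumes "finite (carrier G)" "x \<in> carrier (burnside_ring G)"
  shows "core_coeff G M x =
    (\<Sum>H\<in>subgroup_reps G. if normal_core G H = M then basis_coeff G x H else 0)"
proof -
  have "core_coeff G M x = (\<Sum>H\<in>{H \<in> subgroup_reps G. normal_core G H = M}. basis_coeff G x H)"
    unfolding core_coeff_def burnside_coeffs_eq(1)[OF assms] by (intro sum.cong) auto
  then show ?thesis
    using finite_subgroup_reps[OF assms(1)] by (simp only: sum.inter_filter)
qed

lemma mark_core_compression:
  assumes fin: "finite (carrier G)" and x: "x \<in> carrier (burnside_ring G)"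
  shows "core_compression G x \<in> carrier (burnside_ring G)"
    and "mark G (core_compression G x) L =
      (\<Sum>H\<in>subgroup_reps G. basis_coeff G x H * int (stab_count G (coset_gset G (normal_core G H)) L))"
proof -
  have core: "finite_gset G (coset_gset G (normal_core G H))" if "H \<in> subgroup_reps G" for H
    using that fin by (intro finite_coset_gset subgroup_normal_core subgroup_reps_subgroup)
  show "core_compression G x \<in> carrier (burnside_ring G)"
    unfolding core_compression_def
    by (rule burnside_lincomb(1)[OF finite_subgroup_reps[OF fin]]) (rule core)
  have "mark G (core_compression G x) L = (\<Sum>H\<in>subgroup_reps G.
      burnside_coeffs G x H * int (stab_count G (coset_gset G (normal_core G H)) L))"
    unfolding core_compression_def
    by (rule burnside_lincomb(2)[OF finite_subgroup_reps[OF fin]]) (rule core)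
  also have "\<dots> = (\<Sum>H\<in>subgroup_reps G. basis_coeff G x H * int (stab_count G (coset_gset G (normal_core G H)) L))"
    unfolding burnside_coeffs_eq(1)[OF fin x] by (intro sum.cong) simp_all
  finally show "mark G (core_compression G x) L =
      (\<Sum>H\<in>subgroup_reps G. basis_coeff G x H * int (stab_count G (coset_gset G (normal_core G H)) L))" .
qed

end

section \<open>Subgroups of the quotient and inflation\<close>

lemma conj_eq_image: "x <#\<^bsub>G\<^esub> A #>\<^bsub>G\<^esub> y = (\<lambda>a. x \<otimes>\<^bsub>G\<^esub> a \<otimes>\<^bsub>G\<^esub> y) ` A"
  by (auto simp: l_coset_def r_coset_def)

section \<open>The correspondence theorem for subgroups of the quotient\<close>

context normal
begin

text \<open>In this context \<open>H\<close> is the normal subgroup, called \<open>N\<close> in the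
  theorem. For a subgroup \<open>A\<close>, this is \<open>A/H\<close> if \<open>A\<close> contains
  \<open>H\<close>, and \<open>AH/H\<close> in general.\<close>

abbreviation proj :: "'a set \<Rightarrow> 'a set set" where
  "proj A \<equiv> (\<lambda>a. H #> a) ` A"

lemma proj_in_carrier [simp]: "g \<in> carrier G \<Longrightarrow> H #> g \<in> carrier (G Mod H)"
  by (auto simp: FactGroup_def RCOSETS_def)

lemma carrier_FactGroupE:
  assumes "q \<in> carrier (G Mod H)"
  obtains g where "g \<in> carrier G" "q = H #> g"
  using assms by (auto simp: FactGroup_def RCOSETS_def)

lemma proj_inv: "g \<in> carrier G \<Longrightarrow> inv\<^bsub>G Mod H\<^esub> (H #> g) = H #> inv g"
  using inv_FactGroup[of "H #> g"] by (simp add: rcos_inv)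

lemma finite_FactGroup: "finite (carrier G) \<Longrightarrow> finite (carrier (G Mod H))"
  by (simp add: FactGroup_def RCOSETS_def)

lemma proj_subset: "A \<subseteq> carrier G \<Longrightarrow> proj A \<subseteq> carrier (G Mod H)"
  by auto

text \<open>A subgroup above \<open>H\<close> is a union of cosets of \<open>H\<close>, so
  membership can be tested on cosets.\<close>

lemma proj_mem_iff:
  assumes A: "subgroup A G" "H \<subseteq> A" and g: "g \<in> carrier G"
  shows "H #> g \<in> proj A \<longleftrightarrow> g \<in> A"
proof
  assume "H #> g \<in> proj A"
  then obtain a where a: "a \<in> A" "H #> g = H #> a" by blast
  have "g \<in> H #> a"
    using a rcos_self[OF g subgroup_axioms] by simp
  then show "g \<in> A"
    using a A subgroup.m_closed[OF A(1)] by (auto simp: r_coset_def)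
qed simp

lemma proj_eq_iff:
  assumes "subgroup A G" "H \<subseteq> A" "subgroup B G" "H \<subseteq> B"
  shows "proj A = proj B \<longleftrightarrow> A = B"
proof
  assume *: "proj A = proj B"
  have "g \<in> A \<longleftrightarrow> g \<in> B" if "g \<in> carrier G" for g
    using * that proj_mem_iff[OF assms(1,2) that] proj_mem_iff[OF assms(3,4) that] by simp
  then show "A = B"
    using assms subgroup.subset by blast
qed simp

lemma proj_subgroup:
  assumes "subgroup A G"
  shows "subgroup (proj A) (G Mod H)"
proof -
  interpret Q: group "G Mod H" by (rule factorgroup_is_group)
  note A = subgroup.subset[OF assms, THEN subsetD]
  show ?thesis
  proof (rule Q.subgroupI)
    show "proj A \<subseteq> carrier (G Mod H)"
      using subgroup.subset[OF assms] by (rule proj_subset)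
    show "proj A \<noteq> {}"
      using subgroup.one_closed[OF assms] by blast
  next
    fix q assume "q \<in> proj A"
    then obtain a where "a \<in> A" "q = H #> a" by blast
    then show "inv\<^bsub>G Mod H\<^esub> q \<in> proj A"
      using A subgroup.m_inv_closed[OF assms] by (simp add: proj_inv)
  next
    fix q r assume "q \<in> proj A" "r \<in> proj A"
    then obtain a b where "a \<in> A" "q = H #> a" "b \<in> A" "r = H #> b" by blast
    then show "q \<otimes>\<^bsub>G Mod H\<^esub> r \<in> proj A"
      using A subgroup.m_closed[OF assms] by (simp add: rcos_sum)
  qed
qed

text \<open>The surjective half of the correspondence; \<open>proj_eq_iff\<close> is the injective
  one. The preimage is given explicitly because stabilizers of inflated sets arise in that
  form.\<close>

lemma subgroup_FactGroupE:
  assumes "subgroup K (G Mod H)"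
  obtains A where "subgroup A G" "H \<subseteq> A" "K = proj A" "A = {g \<in> carrier G. H #> g \<in> K}"
proof (rule that[OF _ _ _ refl])
  let ?A = "{g \<in> carrier G. H #> g \<in> K}"
  show "subgroup ?A G"
    using factgroup_subgroup_union_subgroup[OF assms]
    unfolding factgroup_subgroup_union_char[OF assms] .
  have "H \<in> K"
    using subgroup.one_closed[OF assms] by (simp add: FactGroup_def)
  then show "H \<subseteq> ?A"
    by (simp add: subset_iff rcos_const[OF is_group])
  show "K = proj ?A"
  proof (intro subset_antisym subsetI)
    fix q assume q: "q \<in> K"
    obtain g where "g \<in> carrier G" "q = H #> g"
      using subsetD[OF subgroup.subset[OF assms] q] by (rule carrier_FactGroupE)
    then show "q \<in> proj ?A" using q by simp
  next
    fix q assume "q \<in> proj ?A"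
    then show "q \<in> K" by blast
  qed
qed

lemma conj_proj:
  assumes "A \<subseteq> carrier G" "g \<in> carrier G"
  shows "proj (g <# A #> inv g) = (H #> g) <#\<^bsub>G Mod H\<^esub> proj A #>\<^bsub>G Mod H\<^esub> inv\<^bsub>G Mod H\<^esub> (H #> g)"
proof -
  have "proj (g <# A #> inv g) = (\<lambda>a. H #> (g \<otimes> a \<otimes> inv g)) ` A"
    by (simp add: conj_eq_image image_image)
  also have "\<dots> = (\<lambda>a. (H #> g) \<otimes>\<^bsub>G Mod H\<^esub> (H #> a) \<otimes>\<^bsub>G Mod H\<^esub> inv\<^bsub>G Mod H\<^esub> (H #> g)) ` A"
    using assms by (intro image_cong) (auto simp: proj_inv rcos_sum subset_iff)
  also have "\<dots> = (H #> g) <#\<^bsub>G Mod H\<^esub> proj A #>\<^bsub>G Mod H\<^esub> inv\<^bsub>G Mod H\<^esub> (H #> g)"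
    by (simp only: conj_eq_image image_image)
  finally show ?thesis .
qed

lemma subset_conj:
  assumes "A \<subseteq> carrier G" "H \<subseteq> A" "g \<in> carrier G"
  shows "H \<subseteq> g <# A #> inv g"
proof
  fix k assume k: "k \<in> H"
  then have "inv g \<otimes> k \<otimes> g \<in> A"
    using inv_op_closed1[OF assms(3)] assms by blast
  then show "k \<in> g <# A #> inv g"
    using mem_conj_iff[OF assms(3,1)] k by simp
qed

lemma conjugate_proj:
  assumes "subgroup A G" "conjugate G A B"
  shows "conjugate (G Mod H) (proj A) (proj B)"
proof -
  obtain g where g: "g \<in> carrier G" "B = g <# A #> inv g"
    using assms(2) by (auto simp: conjugate_def)
  show ?thesis
    unfolding conjugate_def g(2) conj_proj[OF subgroup.subset[OF assms(1)] g(1)]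
    by (rule bexI[OF _ proj_in_carrier[OF g(1)]]) (rule refl)
qed

text \<open>Any lift \<open>g\<close> of the conjugating coset works: the conjugate of
  \<open>A\<close> by \<open>g\<close> and \<open>B\<close> both contain \<open>H\<close> and have
  the same image, so they coincide.\<close>

lemma conjugate_projD:
  assumes A: "subgroup A G" "H \<subseteq> A" and B: "subgroup B G" "H \<subseteq> B"
    and "conjugate (G Mod H) (proj A) (proj B)"
  shows "conjugate G A B"
proof -
  obtain q where q: "q \<in> carrier (G Mod H)"
      "proj B = q <#\<^bsub>G Mod H\<^esub> proj A #>\<^bsub>G Mod H\<^esub> inv\<^bsub>G Mod H\<^esub> q"
    using assms(5) by (auto simp: conjugate_def)
  obtain g where g: "g \<in> carrier G" "q = H #> g"
    using q(1) by (rule carrier_FactGroupE)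
  have "proj (g <# A #> inv g) = proj B"
    using conj_proj[OF subgroup.subset[OF A(1)] g(1)] q(2) g(2) by simp
  then have "g <# A #> inv g = B"
    using proj_eq_iff[OF subgroup_conjugation_is_surj2[OF g(1) A(1)]
        subset_conj[OF subgroup.subset[OF A(1)] A(2) g(1)] B] by simp
  then show ?thesis
    using g(1) by (auto simp: conjugate_def)
qed

text \<open>The core lies in \<open>A\<close> (take the identity), and by normality \<open>H\<close>
  lies in every conjugate of \<open>A\<close> as soon as it lies in \<open>A\<close>.\<close>

lemma subset_normal_core_iff:
  assumes "A \<subseteq> carrier G"
  shows "H \<subseteq> normal_core G A \<longleftrightarrow> H \<subseteq> A"
proof
  assume "H \<subseteq> normal_core G A"
  moreover have "k \<in> A" if "k \<in> normal_core G A" for k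
  proof -
    have "k \<in> carrier G" "inv \<one> \<otimes> k \<otimes> \<one> \<in> A"
      using that one_closed mem_normal_core_iff[OF assms] by blast+
    then show ?thesis by simp
  qed
  ultimately show "H \<subseteq> A" by blast
next
  assume "H \<subseteq> A"
  then show "H \<subseteq> normal_core G A"
    unfolding normal_core_def using subset_conj[OF assms] by blast
qed

text \<open>\<open>proj_mem_iff\<close> is used twice, for \<open>A\<close> and for its core, which
  also contains \<open>H\<close>; both conditions on a coset become conditions on one of its
  elements.\<close>

lemma normal_core_proj:
  assumes A: "subgroup A G" "H \<subseteq> A"
  shows "normal_core (G Mod H) (proj A) = proj (normal_core G A)"
proof -
  interpret Q: group "G Mod H" by (rule factorgroup_is_group)
  have subA: "A \<subseteq> carrier G" using A(1) by (rule subgroup.subset)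
  have core: "subgroup (normal_core G A) G" "H \<subseteq> normal_core G A"
    using subgroup_normal_core[OF A(1)] subset_normal_core_iff[OF subA] A(2) by auto
  have carr: "carrier (G Mod H) = proj (carrier G)"
    by (auto simp: FactGroup_def RCOSETS_def)
  have "H #> k \<in> normal_core (G Mod H) (proj A) \<longleftrightarrow> H #> k \<in> proj (normal_core G A)"
    if k: "k \<in> carrier G" for k
  proof -
    have "H #> k \<in> normal_core (G Mod H) (proj A) \<longleftrightarrow>
        (\<forall>g\<in>carrier G. inv\<^bsub>G Mod H\<^esub> (H #> g) \<otimes>\<^bsub>G Mod H\<^esub> (H #> k) \<otimes>\<^bsub>G Mod H\<^esub> (H #> g) \<in> proj A)"
      unfolding Q.mem_normal_core_iff[OF proj_subset[OF subA]] using k by (simp add: carr)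
    also have "\<dots> \<longleftrightarrow> (\<forall>g\<in>carrier G. inv g \<otimes> k \<otimes> g \<in> A)"
      using k by (intro ball_cong refl) (simp add: proj_inv rcos_sum proj_mem_iff[OF A])
    also have "\<dots> \<longleftrightarrow> k \<in> normal_core G A"
      using mem_normal_core_iff[OF subA] k by simp
    finally show ?thesis
      using proj_mem_iff[OF core k] by simp
  qed
  moreover have "normal_core (G Mod H) (proj A) \<subseteq> carrier (G Mod H)"
    using Q.mem_normal_core_iff[OF proj_subset[OF subA]] by blast
  moreover have "proj (normal_core G A) \<subseteq> carrier (G Mod H)"
    using core subgroup.subset by (intro proj_subset)
  ultimately show ?thesis
    using carrier_FactGroupE by (intro subset_antisym subsetI) (metis subsetD)+
qed

section \<open>Matching the representatives of both groups\<close>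

lemma sum_subgroup_reps_FactGroup:
  fixes f :: "'a set set \<Rightarrow> int"
  assumes "finite (carrier G)"
    and f: "\<And>K L. subgroup K (G Mod H) \<Longrightarrow> conjugate (G Mod H) K L \<Longrightarrow> f L = f K"
  shows "(\<Sum>K\<in>subgroup_reps (G Mod H). f K) =
    (\<Sum>A\<in>subgroup_reps G. if H \<subseteq> A then f (proj A) else 0)"
proof -
  interpret Q: group "G Mod H" by (rule factorgroup_is_group)
  \<comment> \<open>\<open>proj A\<close> need not be a chosen representative; \<open>r\<close>
    replaces it by the one in its class. Invariance of \<open>f\<close> later undoes the
    replacement.\<close>
  define r where "r A = (SOME K. K \<in> subgroup_reps (G Mod H) \<and> conjugate (G Mod H) (proj A) K)" for A
  have r: "r A \<in> subgroup_reps (G Mod H)" "conjugate (G Mod H) (proj A) (r A)" if A: "subgroup A G" for A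
  proof -
    obtain K where "K \<in> subgroup_reps (G Mod H)" "conjugate (G Mod H) (proj A) K"
      using proj_subgroup[OF A] by (rule Q.subgroup_reps_exists)
    then have "\<exists>K. K \<in> subgroup_reps (G Mod H) \<and> conjugate (G Mod H) (proj A) K" by blast
    from someI_ex[OF this]
    show "r A \<in> subgroup_reps (G Mod H)" "conjugate (G Mod H) (proj A) (r A)"
      unfolding r_def by blast+
  qed
  let ?R = "{A \<in> subgroup_reps G. H \<subseteq> A}"
  have "bij_betw r ?R (subgroup_reps (G Mod H))"
  proof (rule bij_betw_imageI)
    show "inj_on r ?R"
    proof (rule inj_onI)
      fix A B assume AB: "A \<in> ?R" "B \<in> ?R" "r A = r B"
      then have sub: "subgroup A G" "subgroup B G" using subgroup_reps_subgroup by auto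
      have "conjugate (G Mod H) (r B) (proj B)"
        using Q.conjugate_sym[OF proj_subgroup[OF sub(2)] r(2)[OF sub(2)]] .
      then have "conjugate (G Mod H) (proj A) (proj B)"
        using Q.conjugate_trans[OF proj_subgroup[OF sub(1)] r(2)[OF sub(1)]] AB(3) by simp
      then have "conjugate G A B"
        using conjugate_projD sub AB by simp
      then show "A = B"
        using subgroup_reps_unique AB by simp
    qed
    show "r ` ?R = subgroup_reps (G Mod H)"
    proof (intro subset_antisym subsetI)
      fix K assume "K \<in> r ` ?R"
      then show "K \<in> subgroup_reps (G Mod H)" using r(1) subgroup_reps_subgroup by auto
    next
      fix K assume K: "K \<in> subgroup_reps (G Mod H)"
      obtain A where A: "subgroup A G" "H \<subseteq> A" "K = proj A"
        using Q.subgroup_reps_subgroup[OF K] by (rule subgroup_FactGroupE)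
      obtain B where B: "B \<in> subgroup_reps G" "conjugate G A B"
        using A(1) by (rule subgroup_reps_exists)
      have subB: "subgroup B G" using B(1) by (rule subgroup_reps_subgroup)
      \<comment> \<open>By normality, containing \<open>H\<close> depends only on the conjugacy
        class.\<close>
      have "H \<subseteq> B"
        using B(2) subset_conj[OF subgroup.subset[OF A(1)] A(2)] by (auto simp: conjugate_def)
      have "conjugate (G Mod H) K (proj B)"
        unfolding A(3) using conjugate_proj[OF A(1) B(2)] .
      then have "conjugate (G Mod H) K (r B)"
        using Q.conjugate_trans[OF Q.subgroup_reps_subgroup[OF K]] r(2)[OF subB] by blast
      then have "K = r B"
        using Q.subgroup_reps_unique[OF K r(1)[OF subB]] by simp
      then show "K \<in> r ` ?R"
        using B(1) \<open>H \<subseteq> B\<close> by blast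
    qed
  qed
  then have "(\<Sum>K\<in>subgroup_reps (G Mod H). f K) = (\<Sum>A\<in>?R. f (r A))"
    by (rule sum.reindex_bij_betw[symmetric])
  also have "\<dots> = (\<Sum>A\<in>?R. f (proj A))"
    using f[OF proj_subgroup r(2)] subgroup_reps_subgroup by (intro sum.cong) auto
  also have "\<dots> = (\<Sum>A\<in>subgroup_reps G. if H \<subseteq> A then f (proj A) else 0)"
    by (rule sum.inter_filter[OF finite_subgroup_reps[OF assms(1)]])
  finally show ?thesis .
qed

section \<open>Inflation of G-sets and of their classes\<close>

lemma finite_gset_inflate:
  assumes "finite_gset (G Mod H) X"
  shows "finite_gset G (inflate_gset G H X)"
proof -
  interpret X: group_action "G Mod H" "fst X" "snd X" using assms by (simp add: finite_gset_def)
  have "group_action G (fst (inflate_gset G H X)) (snd (inflate_gset G H X))"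
  proof (rule group_actionI)
    show "snd (inflate_gset G H X) \<one> p = p" if "p \<in> fst (inflate_gset G H X)" for p
      using that X.action_one subset by (simp add: inflate_gset_def)
    show "snd (inflate_gset G H X) (g \<otimes> h) p = snd (inflate_gset G H X) g (snd (inflate_gset G H X) h p)"
      if "g \<in> carrier G" "h \<in> carrier G" "p \<in> fst (inflate_gset G H X)" for g h p
      using that X.composition_rule[of p "H #> g" "H #> h"] by (simp add: inflate_gset_def rcos_sum)
  qed (auto simp: inflate_gset_def X.action_extensional X.action_closed)
  then show ?thesis
    using assms by (simp add: finite_gset_def) (simp add: inflate_gset_def)
qed

lemma stabilizer_inflate:
  "stabilizer G (snd (inflate_gset G H X)) p = {g \<in> carrier G. H #> g \<in> stabilizer (G Mod H) (snd X) p}"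
  by (auto simp: stabilizer_def inflate_gset_def)

text \<open>The condition \<open>subgroup A G\<close> matters: a set containing \<open>H\<close>
  need not be a union of cosets, yet its image may be a subgroup.\<close>

lemma stab_count_inflate:
  assumes X: "finite_gset (G Mod H) X"
  shows "stab_count G (inflate_gset G H X) A =
    (if subgroup A G \<and> H \<subseteq> A then stab_count (G Mod H) X (proj A) else 0)"
proof -
  interpret X: group_action "G Mod H" "fst X" "snd X" using X by (simp add: finite_gset_def)
  have key: "stabilizer G (snd (inflate_gset G H X)) p = A \<longleftrightarrow>
      subgroup A G \<and> H \<subseteq> A \<and> stabilizer (G Mod H) (snd X) p = proj A" if p: "p \<in> fst X" for p
  proof -
    \<comment> \<open>\<open>B\<close> is the preimage of the stabilizer. Subgroups above
      \<open>H\<close> with the same image agree, so comparing \<open>A\<close> with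
      \<open>B\<close> can be done in the quotient.\<close>
    obtain B where B: "subgroup B G" "H \<subseteq> B" "stabilizer (G Mod H) (snd X) p = proj B"
        "B = {g \<in> carrier G. H #> g \<in> stabilizer (G Mod H) (snd X) p}"
      using X.stabilizer_subgroup[OF p] by (rule subgroup_FactGroupE)
    have stab: "stabilizer G (snd (inflate_gset G H X)) p = B"
      unfolding stabilizer_inflate by (rule B(4)[symmetric])
    show ?thesis
    proof
      assume "stabilizer G (snd (inflate_gset G H X)) p = A"
      then have "A = B" using stab by (rule trans[OF sym])
      then show "subgroup A G \<and> H \<subseteq> A \<and> stabilizer (G Mod H) (snd X) p = proj A"
        using B(1-3) by simp
    next
      assume A: "subgroup A G \<and> H \<subseteq> A \<and> stabilizer (G Mod H) (snd X) p = proj A"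
      then have "proj B = proj A" unfolding B(3) by simp
      then show "stabilizer G (snd (inflate_gset G H X)) p = A"
        unfolding stab using proj_eq_iff[OF B(1,2), of A] A by simp
    qed
  qed
  have fst_eq: "fst (inflate_gset G H X) = fst X"
    by (simp add: inflate_gset_def)
  show ?thesis
  proof (cases "subgroup A G \<and> H \<subseteq> A")
    case True
    then have "{p \<in> fst X. stabilizer G (snd (inflate_gset G H X)) p = A} =
        {p \<in> fst X. stabilizer (G Mod H) (snd X) p = proj A}"
      using key by (intro Collect_cong conj_cong refl) simp
    then show ?thesis
      unfolding stab_count_def fst_eq using True by simp
  next
    case False
    then have "{p \<in> fst X. stabilizer G (snd (inflate_gset G H X)) p = A} = {}"
      by (auto simp: key)
    then show ?thesis
      unfolding stab_count_def fst_eq using False by (simp only: card.empty if_False)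
  qed
qed

text \<open>The counts of an inflated pair depend only on those of the pair, so the union defining
  \<open>inflation\<close> is over one and the same class.\<close>

lemma mark_inflation:
  assumes x: "x \<in> carrier (burnside_ring (G Mod H))"
  shows "inflation G H x \<in> carrier (burnside_ring G)"
    and "mark G (inflation G H x) A = (if subgroup A G \<and> H \<subseteq> A then mark (G Mod H) x (proj A) else 0)"
proof -
  interpret Q: group "G Mod H" by (rule factorgroup_is_group)
  obtain P Q :: "('a set, nat) gset" where P: "finite_gset (G Mod H) P" "finite_gset (G Mod H) Q"
      "mark (G Mod H) x = stab_diff (G Mod H) P Q"
    using x by (rule Q.in_carrierE)
  let ?z = "burnside_diff G (inflate_gset G H P) (inflate_gset G H Q)"
  have diff: "stab_diff G (inflate_gset G H X) (inflate_gset G H Y) =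
      (\<lambda>A. if subgroup A G \<and> H \<subseteq> A then stab_diff (G Mod H) X Y (proj A) else 0)"
    if "finite_gset (G Mod H) X" "finite_gset (G Mod H) Y" for X Y :: "('a set, nat) gset"
    using that by (simp add: stab_diff_def stab_count_inflate fun_eq_iff)
  have z: "inflation G H x = ?z"
    unfolding inflation_def using P
    by (intro Q.UN_burnside_diff[OF x] burnside_diff_cong) (simp_all add: finite_gset_inflate diff fun_eq_iff)
  show "inflation G H x \<in> carrier (burnside_ring G)"
    unfolding z using P by (intro burnside_diff_in_carrier finite_gset_inflate)
  show "mark G (inflation G H x) A = (if subgroup A G \<and> H \<subseteq> A then mark (G Mod H) x (proj A) else 0)"
    unfolding z using P by (simp add: mark_burnside_diff finite_gset_inflate diff)
qed

text \<open>The inflation of \<open>(G/H)/(A/H)\<close> is \<open>G/A\<close>: it is transitive, and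
  its point \<open>proj A\<close> has stabilizer \<open>A\<close> in \<open>G\<close>.\<close>

lemma stab_count_coset_gset_proj:
  assumes fin: "finite (carrier G)" and A: "subgroup A G" "H \<subseteq> A" and L: "subgroup L G"
  shows "stab_count G (coset_gset G A) L =
    (if H \<subseteq> L then stab_count (G Mod H) (coset_gset (G Mod H) (proj A)) (proj L) else 0)"
proof -
  interpret Q: group "G Mod H" by (rule factorgroup_is_group)
  let ?X = "coset_gset (G Mod H) (proj A)"
  have X: "finite_gset (G Mod H) ?X"
    using Q.finite_coset_gset[OF finite_FactGroup[OF fin] proj_subgroup[OF A(1)]] .
  have I: "finite_gset G (inflate_gset G H ?X)"
    using X by (rule finite_gset_inflate)
  note base = Q.coset_gset_base[OF proj_subgroup[OF A(1)]]
  have carr: "carrier (G Mod H) = proj (carrier G)"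
    by (auto simp: FactGroup_def RCOSETS_def)
  \<comment> \<open>Every element of the quotient is the image of some \<open>g\<close>, so
    \<open>G\<close> and the quotient have the same orbits.\<close>
  have orbit: "fst (inflate_gset G H ?X) = orbit G (snd (inflate_gset G H ?X)) (proj A)"
  proof -
    have "fst (inflate_gset G H ?X) = orbit (G Mod H) (snd ?X) (proj A)"
      using base(3) by (simp add: inflate_gset_def)
    also have "\<dots> = orbit G (snd (inflate_gset G H ?X)) (proj A)"
      by (auto simp: orbit_def inflate_gset_def carr)
    finally show ?thesis .
  qed
  have stab: "stabilizer G (snd (inflate_gset G H ?X)) (proj A) = A"
    unfolding stabilizer_inflate base(2) using proj_mem_iff[OF A] subgroup.subset[OF A(1)] by blast
  have "gset_iso G (inflate_gset G H ?X) (coset_gset G A)"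
    using gset_iso_coset_gset[OF _ _ orbit] I base(1) unfolding stab
    by (simp add: finite_gset_def) (simp add: inflate_gset_def)
  then have "stab_count G (coset_gset G A) L = stab_count G (inflate_gset G H ?X) L"
    by (rule stab_count_iso[OF I, symmetric])
  then show ?thesis
    using stab_count_inflate[OF X, of L] L by simp
qed

section \<open>Coefficients and compression under inflation\<close>

text \<open>For \<open>A\<close> above \<open>H\<close> numerator and divisor both equal those at
  \<open>proj A\<close>; otherwise the numerator is zero.\<close>

lemma basis_coeff_inflation:
  assumes fin: "finite (carrier G)" and x: "x \<in> carrier (burnside_ring (G Mod H))" and A: "subgroup A G"
  shows "basis_coeff G (inflation G H x) A = (if H \<subseteq> A then basis_coeff (G Mod H) x (proj A) else 0)"
  using A stab_count_coset_gset_proj[OF fin A _ A]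
  by (simp add: basis_coeff_def mark_inflation[OF x])

lemma core_coeff_inflation:
  assumes fin: "finite (carrier G)" and x: "x \<in> carrier (burnside_ring (G Mod H))" and M: "subgroup M G"
  shows "core_coeff G M (inflation G H x) =
    (if H \<subseteq> M then core_coeff (G Mod H) (proj M) x else 0)"
proof -
  interpret Q: group "G Mod H" by (rule factorgroup_is_group)
  have finQ: "finite (carrier (G Mod H))" using fin by (rule finite_FactGroup)
  have lhs: "core_coeff G M (inflation G H x) = (\<Sum>A\<in>subgroup_reps G.
      if H \<subseteq> A then if normal_core G A = M then basis_coeff (G Mod H) x (proj A) else 0 else 0)"
    unfolding core_coeff_eq[OF fin mark_inflation(1)[OF x]]
    by (intro sum.cong) (auto simp: basis_coeff_inflation[OF fin x] subgroup_reps_subgroup)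
  show ?thesis
  proof (cases "H \<subseteq> M")
    case True
    have "core_coeff (G Mod H) (proj M) x = (\<Sum>A\<in>subgroup_reps G.
        if H \<subseteq> A then if normal_core (G Mod H) (proj A) = proj M
          then basis_coeff (G Mod H) x (proj A) else 0 else 0)"
      unfolding Q.core_coeff_eq[OF finQ x]
      by (rule sum_subgroup_reps_FactGroup[OF fin])
        (simp add: Q.normal_core_conjugate Q.basis_coeff_conjugate[OF finQ x])
    also have "\<dots> = core_coeff G M (inflation G H x)"
    proof -
      have "normal_core (G Mod H) (proj A) = proj M \<longleftrightarrow> normal_core G A = M"
        if "A \<in> subgroup_reps G" "H \<subseteq> A" for A
      proof -
        have A: "subgroup A G" using that subgroup_reps_subgroup by blast
        show ?thesis
          unfolding normal_core_proj[OF A that(2)]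
          using proj_eq_iff[OF subgroup_normal_core[OF A] _ M True]
            subset_normal_core_iff[OF subgroup.subset[OF A]] that(2) by simp
      qed
      then show ?thesis
        unfolding lhs by (intro sum.cong) auto
    qed
    finally show ?thesis using True by simp
  next
    case False
    \<comment> \<open>The core of a subgroup above \<open>H\<close> contains \<open>H\<close>,
      whereas \<open>M\<close> does not.\<close>
    have "normal_core G A \<noteq> M" if "A \<in> subgroup_reps G" "H \<subseteq> A" for A
      using that False subset_normal_core_iff[OF subgroup.subset[OF subgroup_reps_subgroup]] by blast
    then show ?thesis
      unfolding lhs using False by (auto intro!: sum.neutral)
  qed
qed

lemma core_compression_inflation:
  assumes fin: "finite (carrier G)" and x: "x \<in> carrier (burnside_ring (G Mod H))"
  shows "core_compression G (inflation G H x) = inflation G H (core_compression (G Mod H) x)"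
proof -
  interpret Q: group "G Mod H" by (rule factorgroup_is_group)
  have finQ: "finite (carrier (G Mod H))" using fin by (rule finite_FactGroup)
  note Inf = mark_inflation[OF x]
  note compQ = Q.mark_core_compression[OF finQ x]
  show ?thesis
  proof (rule mark_eq_subgroupI)
    show "core_compression G (inflation G H x) \<in> carrier (burnside_ring G)"
      using mark_core_compression(1)[OF fin Inf(1)] .
    show "inflation G H (core_compression (G Mod H) x) \<in> carrier (burnside_ring G)"
      using mark_inflation(1)[OF compQ(1)] .
    fix L assume L: "subgroup L G"
    let ?g = "\<lambda>K. basis_coeff (G Mod H) x K *
        int (stab_count (G Mod H) (coset_gset (G Mod H) (normal_core (G Mod H) K)) (proj L))"
    \<comment> \<open>The coefficient kills every \<open>A\<close> not above \<open>H\<close>. For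
      the others the core contains \<open>H\<close>, hence so do all stabilizers in its coset space,
      and the count at \<open>L\<close> vanishes unless \<open>L\<close> contains
      \<open>H\<close>.\<close>
    have "mark G (core_compression G (inflation G H x)) L =
        (\<Sum>A\<in>subgroup_reps G. if H \<subseteq> A then if H \<subseteq> L then ?g (proj A) else 0 else 0)"
      unfolding mark_core_compression(2)[OF fin Inf(1)]
    proof (rule sum.cong[OF refl])
      fix A assume "A \<in> subgroup_reps G"
      then have A: "subgroup A G" by (rule subgroup_reps_subgroup)
      have "stab_count G (coset_gset G (normal_core G A)) L = (if H \<subseteq> L then
          stab_count (G Mod H) (coset_gset (G Mod H) (normal_core (G Mod H) (proj A))) (proj L) else 0)"
        if "H \<subseteq> A"
        unfolding normal_core_proj[OF A that]
        using stab_count_coset_gset_proj[OF fin subgroup_normal_core[OF A] _ L]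
          subset_normal_core_iff[OF subgroup.subset[OF A]] that by simp
      then show "basis_coeff G (inflation G H x) A * int (stab_count G (coset_gset G (normal_core G A)) L) =
          (if H \<subseteq> A then if H \<subseteq> L then ?g (proj A) else 0 else 0)"
        by (simp add: basis_coeff_inflation[OF fin x A])
    qed
    also have "\<dots> = (if H \<subseteq> L then \<Sum>A\<in>subgroup_reps G. if H \<subseteq> A then ?g (proj A) else 0 else 0)"
      by (simp cong: if_cong)
    also have "(\<Sum>A\<in>subgroup_reps G. if H \<subseteq> A then ?g (proj A) else 0) = (\<Sum>K\<in>subgroup_reps (G Mod H). ?g K)"
      by (rule sum_subgroup_reps_FactGroup[OF fin, symmetric])
        (simp add: Q.normal_core_conjugate Q.basis_coeff_conjugate[OF finQ x])
    also have "\<dots> = mark (G Mod H) (core_compression (G Mod H) x) (proj L)"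
      using compQ(2) by simp
    finally show "mark G (core_compression G (inflation G H x)) L =
        mark G (inflation G H (core_compression (G Mod H) x)) L"
      unfolding mark_inflation(2)[OF compQ(1)] using L by simp
  qed
qed

end

theorem proposition5p1:
  fixes G :: "('a, 'b) monoid_scheme" and N :: "'a set" and x :: "'a set burnside"
  assumes "group G" and "finite (carrier G)" and "N \<lhd> G"
    and "x \<in> carrier (burnside_ring (G Mod N))"
  shows "core_compression G (inflation G N x) = inflation G N (core_compression (G Mod N) x) \<and>
    (\<forall>M. M \<lhd> G \<longrightarrow>
      core_coeff G M (inflation G N x) =
        (if N \<subseteq> M
         then core_coeff (G Mod N) (carrier (G\<lparr>carrier := M\<rparr> Mod N)) x
         else 0))"
proof -
  interpret normal N G by fact
  \<comment> \<open>Cosets of \<open>N\<close> are computed with the same multiplication in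
    \<open>M\<close> as in \<open>G\<close>, so \<open>M/N\<close> is literally a set of elements of
    \<open>G Mod N\<close>.\<close>
  have "carrier (G\<lparr>carrier := M\<rparr> Mod N) = proj M" for M
    by (auto simp: FactGroup_def RCOSETS_def)
  then show ?thesis
    using core_compression_inflation[OF assms(2,4)]
      core_coeff_inflation[OF assms(2,4) normal_imp_subgroup] by simp
qed

end
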